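(* Let $H,F$ be real Hilbert spaces, $A\in\mathcal{L}(H,F)$, $f_*\in\mathcal{R}(A)$, let $u_*$ be the minimum norm solution of $Au=f_*$, and let $f\in F$. Let $0<q<1$, $\alpha_0>0$, $\alpha_j=q\alpha_{j-1}$ for $1\le j\le M$, and $\Omega=\{\alpha_0,\alpha_1,\dots,\alpha_M\}$. Let $L_{min}=\{\alpha^{(1)}_{min}>\dots>\alpha^{(K)}_{min}\}$ be the set of local minimum points on $\Omega$ of the quasi-optimality function $\psi_Q$, and let $\alpha^{(k)}_{max}$, $0\le k\le K$, be the associated maximum points, as defined in the context. The following estimates hold for the local minimum points of the function $\psi_Q$: 1. $$\min_{\alpha\in L_{min}}\|u_\alpha-u_*\|\le q^{-1}C\min_{\alpha_M\le\alpha\le\alpha_0}e_1(\alpha),$$ where $$C:=1+\max_{1\le k\le K}\ \max_{\alpha_j\in\Omega,\ \alpha^{(k)}_{max}\le\alpha_j\le\alpha^{(k-1)}_{max}}T\left(\alpha^{(k)}_{min},\alpha_j\right)\le 1+c_q\ln\left(\frac{\alpha_0}{\alpha_M}\right),$$ $$T(\alpha,\beta):=\frac{\|u_\alpha-u_\beta\|}{\psi_Q(\beta)},\qquad c_q:=\frac{q^{-1}-1}{\ln q^{-1}}\to 1\ \text{ if } q\to 1.$$ 2. Let $u_*=|A|^pv$, $\|v\|\le\rho$, $p>0$ and $\alpha_0=1$. If $\delta_0:=\sqrt{\alpha_M}\le\|f-f_*\|$, then $$\min_{\alpha\in L_{min}}\|u_\alpha-u_*\|\le c_p\ln\frac{\|f-f_*\|}{\delta_0}\;\rho^{\frac1{p+1}}\;\bigl|\ln\|f-f_*\|\bigr|\;\|f-f_*\|^{\frac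 p{p+1}},\qquad 0<p\le 2.$$
   Context: Here $f_*$ is the exact data and $f$ the noisy data; $|A|:=(A^*A)^{1/2}$, and $c_p$ denotes a constant depending on $p$. For $\alpha>0$ the Tikhonov approximations with exact and noisy data are $u^+_\alpha=(\alpha I+A^*A)^{-1}A^*f_*$ and $u_\alpha=(\alpha I+A^*A)^{-1}A^*f$. Define $e_1(\alpha):=\|u^+_\alpha-u_*\|+\|u_\alpha-u^+_\alpha\|$. Let $B_\alpha:=\alpha^{1/2}(\alpha I+AA^* )^{-1/2}$. The quasi-optimality function is $$\psi_Q(\alpha)=\alpha\left\|\frac{du_\alpha}{d\alpha}\right\|=\alpha^{-1}\|A^*B_\alpha^2(Au_\alpha-f)\|.$$ The minimum over $\alpha_M\le\alpha\le\alpha_0$ is over all real $\alpha$ in that interval. Local minimum points on $\Omega$: for $0\le k\le M-1$, $\alpha_k$ is a local minimum point if $\psi_Q(\alpha_k)<\psi_Q(\alpha_{k+1})$ and, in case $k>0$, there exists an index $j\ge 1$ such that $\psi_Q(\alpha_k)=\psi_Q(\alpha_{k-1})=\dots=\psi_Q(\alpha_{k-j+1})<\psi_Q(\alpha_{k-j})$. The parameter $\alpha_M$ is a local minimum point if there exists $j\ge1$ such that $\psi_Q(\alpha_M)=\psi_Q(\alpha_{M-1})=\dots=\psi_Q(\alpha_{M-j+1})<\psi_Q(\alpha_{M-j})$. $K$ is the number of local minimum points, and $L_{min}=\{\alpha^{(k)}_{min}:\alpha^{(1)}_{min}>\alpha^{(2)}_{min}>\dots>\alpha^{(K)}_{min}\}$.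 Local maximum points: for $0<k<M$, $\alpha_k$ is a local maximum point if $\psi_Q(\alpha_k)>\psi_Q(\alpha_{k+1})$ and there exists $j\ge1$ such that $\psi_Q(\alpha_k)=\psi_Q(\alpha_{k-1})=\dots=\psi_Q(\alpha_{k-j+1})>\psi_Q(\alpha_{k-j})$. For $1\le k\le K-1$, $\alpha^{(k)}_{max}$ denotes the local maximum point between $\alpha^{(k+1)}_{min}$ and $\alpha^{(k)}_{min}$; moreover $\alpha^{(0)}_{max}:=\alpha_0$ and $\alpha^{(K)}_{max}:=\alpha_M$. Thus $\alpha^{(0)}_{max}\ge\alpha^{(1)}_{min}>\alpha^{(1)}_{max}>\dots>\alpha^{(K-1)}_{max}>\alpha^{(K)}_{min}\ge\alpha^{(K)}_{max}$.
   Formalization: With δ=‖f−f_*‖: the bound on C and part 2 exclude ψ_Q being constant on α_0,…,α_k (k≥1) and then rising; in part 2 c_p may also depend on q and on κ>0, where ln(δ/δ_0)≥κ, |ln δ|≥κ, κδ≤ρ, κρδ_0^{p+1}≤δ; L_min is assumed nonempty. *)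

theory Defs
  imports "HOL-Analysis.Analysis" "HOL-Computational_Algebra.Polynomial"
begin

(* Real Hilbert spaces are types of sort {real_inner, complete_space}. *)

definition min_norm_solution ::
  "('h::real_inner \<Rightarrow> 'f::real_inner) \<Rightarrow> 'f \<Rightarrow> 'h \<Rightarrow> bool" where
  "min_norm_solution A g u \<longleftrightarrow> A u = g \<and> (\<forall>w. A w = g \<longrightarrow> norm u \<le> norm w)"

definition tikhonov :: "('h::real_inner \<Rightarrow> 'f::real_inner) \<Rightarrow> 'f \<Rightarrow> real \<Rightarrow> 'h" where
  "tikhonov A g \<alpha> = inv (\<lambda>u. \<alpha> *\<^sub>R u + adjoint A (A u)) (adjoint A g)"

definition e1 ::
  "('h::real_inner \<Rightarrow> 'f::real_inner) \<Rightarrow> 'f \<Rightarrow> 'f \<Rightarrow> 'h \<Rightarrow> real \<Rightarrow> real" where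
  "e1 A fstar f ustar \<alpha> =
     norm (tikhonov A fstar \<alpha> - ustar) + norm (tikhonov A f \<alpha> - tikhonov A fstar \<alpha>)"

definition psiQ :: "('h::real_inner \<Rightarrow> 'f::real_inner) \<Rightarrow> 'f \<Rightarrow> real \<Rightarrow> real" where
  "psiQ A f \<alpha> = \<alpha> * norm (vector_derivative (tikhonov A f) (at \<alpha>))"

(* Local extrema of a finite sequence g 0, ..., g M. The bound j \<le> k keeps the index k - j,
   a truncated difference of naturals, inside the sequence. *)

definition local_min_index :: "(nat \<Rightarrow> real) \<Rightarrow> nat \<Rightarrow> nat \<Rightarrow> bool" where
  "local_min_index g M k \<longleftrightarrow>
     (k < M \<and> g k < g (k + 1) \<and>
        (0 < k \<longrightarrow> (\<exists>j\<ge>1. j \<le> k \<and> (\<forall>i<j. g (k - i) = g k) \<and> g k < g (k - j)))) \<or>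
     (k = M \<and> (\<exists>j\<ge>1. j \<le> M \<and> (\<forall>i<j. g (M - i) = g M) \<and> g M < g (M - j)))"

definition local_max_index :: "(nat \<Rightarrow> real) \<Rightarrow> nat \<Rightarrow> nat \<Rightarrow> bool" where
  "local_max_index g M k \<longleftrightarrow>
     0 < k \<and> k < M \<and> g k > g (k + 1) \<and>
     (\<exists>j\<ge>1. j \<le> k \<and> (\<forall>i<j. g (k - i) = g k) \<and> g k > g (k - j))"

(* The sequence starts with a plateau of at least two equal values and then increases.
   Such a plateau is a minimum of the sequence that local_min_index does not count. *)

definition rises_from_initial_plateau :: "(nat \<Rightarrow> real) \<Rightarrow> nat \<Rightarrow> bool" where
  "rises_from_initial_plateau g M \<longleftrightarrow>
     (\<exists>k. 0 < k \<and> k < M \<and> (\<forall>i\<le>k. g i = g 0) \<and> g k < g (k + 1))"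

(* A grid is a decreasing sequence \<alpha> 0, ..., \<alpha> M. *)

definition L_min ::
  "('h::real_inner \<Rightarrow> 'f::real_inner) \<Rightarrow> 'f \<Rightarrow> (nat \<Rightarrow> real) \<Rightarrow> nat \<Rightarrow> real set" where
  "L_min A f \<alpha> M = \<alpha> ` {k. local_min_index (\<lambda>j. psiQ A f (\<alpha> j)) M k}"

definition L_max ::
  "('h::real_inner \<Rightarrow> 'f::real_inner) \<Rightarrow> 'f \<Rightarrow> (nat \<Rightarrow> real) \<Rightarrow> nat \<Rightarrow> real set" where
  "L_max A f \<alpha> M = \<alpha> ` {k. local_max_index (\<lambda>j. psiQ A f (\<alpha> j)) M k}"

definition K_min ::
  "('h::real_inner \<Rightarrow> 'f::real_inner) \<Rightarrow> 'f \<Rightarrow> (nat \<Rightarrow> real) \<Rightarrow> nat \<Rightarrow> nat" where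
  "K_min A f \<alpha> M = card (L_min A f \<alpha> M)"

(* The k-th largest element of L_min, for k = 1, ..., K_min. *)

definition alpha_min ::
  "('h::real_inner \<Rightarrow> 'f::real_inner) \<Rightarrow> 'f \<Rightarrow> (nat \<Rightarrow> real) \<Rightarrow> nat \<Rightarrow> nat \<Rightarrow> real" where
  "alpha_min A f \<alpha> M k = rev (sorted_list_of_set (L_min A f \<alpha> M)) ! (k - 1)"

definition alpha_max ::
  "('h::real_inner \<Rightarrow> 'f::real_inner) \<Rightarrow> 'f \<Rightarrow> (nat \<Rightarrow> real) \<Rightarrow> nat \<Rightarrow> nat \<Rightarrow> real" where
  "alpha_max A f \<alpha> M k =
     (if k = 0 then \<alpha> 0
      else if k = K_min A f \<alpha> M then \<alpha> M
      else (THE \<beta>. \<beta> \<in> L_max A f \<alpha> M \<and>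
                   alpha_min A f \<alpha> M (k + 1) < \<beta> \<and> \<beta> < alpha_min A f \<alpha> M k))"

definition T_quot :: "('h::real_inner \<Rightarrow> 'f::real_inner) \<Rightarrow> 'f \<Rightarrow> real \<Rightarrow> real \<Rightarrow> real" where
  "T_quot A f \<alpha> \<beta> = norm (tikhonov A f \<alpha> - tikhonov A f \<beta>) / psiQ A f \<beta>"

definition C_const ::
  "('h::real_inner \<Rightarrow> 'f::real_inner) \<Rightarrow> 'f \<Rightarrow> (nat \<Rightarrow> real) \<Rightarrow> nat \<Rightarrow> real" where
  "C_const A f \<alpha> M =
     1 + Max ((\<lambda>k. Max ((\<lambda>\<beta>. T_quot A f (alpha_min A f \<alpha> M k) \<beta>) `
                        {\<beta> \<in> \<alpha> ` {0..M}. alpha_max A f \<alpha> M k \<le> \<beta> \<and> \<beta> \<le> alpha_max A f \<alpha> M (k - 1)}))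
              ` {1..K_min A f \<alpha> M})"

definition c_grid :: "real \<Rightarrow> real" where
  "c_grid q = (inverse q - 1) / ln (inverse q)"

(* Continuous functional calculus of a positive self-adjoint bounded operator T, whose spectrum
   lies in [0, ||T||]: if the polynomials P n converge to g uniformly on [0, ||T||], then g(T) is
   the limit of (P n)(T) in operator norm, and it does not depend on the choice of P. *)

definition operator_poly :: "real poly \<Rightarrow> ('h::real_inner \<Rightarrow> 'h) \<Rightarrow> 'h \<Rightarrow> 'h" where
  "operator_poly P T x = (\<Sum>i\<le>degree P. coeff P i *\<^sub>R (T ^^ i) x)"

definition is_operator_function ::
  "(real \<Rightarrow> real) \<Rightarrow> ('h::real_inner \<Rightarrow> 'h) \<Rightarrow> ('h \<Rightarrow> 'h) \<Rightarrow> bool" where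
  "is_operator_function g T S \<longleftrightarrow> bounded_linear S \<and>
     (\<exists>P :: nat \<Rightarrow> real poly.
        uniform_limit {0..onorm T} (\<lambda>n. poly (P n)) g sequentially \<and>
        (\<lambda>n. onorm (\<lambda>x. operator_poly (P n) T x - S x)) \<longlonglongrightarrow> 0)"

(* Used only for s > 0, where \<lambda> powr s is continuous on [0, \<infinity>) with 0 powr s = 0. *)

definition operator_powr :: "('h::real_inner \<Rightarrow> 'h) \<Rightarrow> real \<Rightarrow> 'h \<Rightarrow> 'h" where
  "operator_powr T s = (THE S. is_operator_function (\<lambda>t. t powr s) T S)"

definition operator_abs :: "('h::real_inner \<Rightarrow> 'f::real_inner) \<Rightarrow> 'h \<Rightarrow> 'h" where
  "operator_abs A = operator_powr (adjoint A \<circ> A) (1/2)"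

definition tikhonov_problem ::
  "real \<Rightarrow> ('h::real_inner \<Rightarrow> 'f::real_inner) \<Rightarrow> 'f \<Rightarrow> 'h \<Rightarrow> (nat \<Rightarrow> real) \<Rightarrow> nat \<Rightarrow> bool" where
  "tikhonov_problem q A fstar ustar \<alpha> M \<longleftrightarrow>
     bounded_linear A \<and> fstar \<in> range A \<and> min_norm_solution A fstar ustar \<and>
     0 < \<alpha> 0 \<and> (\<forall>j\<in>{1..M}. \<alpha> j = q * \<alpha> (j - 1))"

(* The bound  c ln(\<delta>/\<delta>0) \<rho>^(1/(p+1)) |ln \<delta>| \<delta>^(p/(p+1))  vanishes for \<delta> = \<delta>0 and for \<delta> = 1, and
   it cannot hold uniformly as \<rho> \<rightarrow> 0 or \<rho> \<rightarrow> \<infinity> with \<delta> and \<delta>0 fixed. The parameter \<kappa> > 0 measures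
   the distance from these degenerate cases; the last two conditions say that, up to a factor
   depending on \<kappa> and p, the a priori choice (\<delta>/\<rho>)^(2/(p+1)) lies in [\<delta>0^2, 1]. All data with
   0 < \<delta>0 < \<delta>, \<delta> \<noteq> 1 and \<rho> > 0 are nondegenerate for some \<kappa>. *)

definition nondegenerate :: "real \<Rightarrow> real \<Rightarrow> real \<Rightarrow> real \<Rightarrow> real \<Rightarrow> bool" where
  "nondegenerate \<kappa> p \<rho> \<delta> \<delta>0 \<longleftrightarrow>
     \<kappa> \<le> ln (\<delta> / \<delta>0) \<and> \<kappa> \<le> \<bar>ln \<delta>\<bar> \<and>
     \<kappa> * \<delta> \<le> \<rho> \<and> \<kappa> * \<rho> * \<delta>0 powr (p + 1) \<le> \<delta>"

end

theory Submission
  imports Defs "HOL-Computational_Algebra.Fundamental_Theorem_Algebra"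
begin

text \<open>
Write \<open>T = A\<^sup>* A\<close> and \<open>R\<^sub>a = (a + T)\<^sup>-\<^sup>1\<close>, so that \<open>u\<^sub>a = R\<^sub>a A\<^sup>* f\<close>. The resolvent identity
\<open>u\<^sub>b - u\<^sub>a = (a - b) R\<^sub>b R\<^sub>a A\<^sup>* f\<close> shows \<open>\<psi>\<^sub>Q(a) = a \<parallel>R\<^sub>a R\<^sub>a A\<^sup>* f\<parallel>\<close>. Since \<open>T\<close> is positive,
\<open>\<parallel>a x + s T x\<parallel>\<close> increases in \<open>a, s \<ge> 0\<close> (\<open>norm_positive_combination_mono\<close>), and this single
monotonicity gives \<open>\<psi>\<^sub>Q \<le> e\<^sub>1\<close> (\<open>psiQ_le_e1\<close>), \<open>e\<^sub>1(b) \<le> (b/a) e\<^sub>1(a)\<close> for \<open>a \<le> b\<close> (\<open>e1_le_scaled\<close>) and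
\<open>\<parallel>u\<^sub>b - u\<^sub>a\<parallel> \<le> (a/b - 1) min(\<psi>\<^sub>Q(a), \<psi>\<^sub>Q(b))\<close> for \<open>b \<le> a\<close> (\<open>norm_tikhonov_step_le\<close>).

The separating maximum points cover the grid by intervals, one for each local minimum point. If
\<open>\<beta>\<close> is a grid point in the interval of the minimum point \<open>\<alpha>\<close>, then
\<open>\<parallel>u\<^sub>\<alpha> - u\<^sub>*\<parallel> \<le> \<parallel>u\<^sub>\<beta> - u\<^sub>*\<parallel> + T_quot \<alpha> \<beta> \<cdot> \<psi>\<^sub>Q(\<beta>) \<le> (1 + T_quot \<alpha> \<beta>) e\<^sub>1(\<beta>)\<close>, and an arbitrary parameter is
rounded up to the grid at the price of a factor \<open>1/q\<close> (\<open>min_error_le_e1\<close>). To bound \<open>T_quot \<alpha> \<beta>\<close>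
logarithmically, the path from \<open>\<beta>\<close> to \<open>\<alpha>\<close> is cut into grid steps. On this path \<open>\<psi>\<^sub>Q\<close> stays below
\<open>\<psi>\<^sub>Q(\<beta>)\<close>, because between consecutive local maxima a sequence falls and then rises
(\<open>valley_side_le\<close>); hence \<open>T_quot \<alpha> \<beta> \<le> M (1/q - 1)\<close>, which is \<open>c_grid q\<close> times \<open>ln (\<alpha>\<^sub>0/\<alpha>\<^sub>M)\<close>.

For the rate the source condition must be turned into \<open>a \<parallel>R\<^sub>a u\<^sub>*\<parallel> \<le> a\<^bsup>p/2\<^esup> \<parallel>v\<parallel>\<close>
(\<open>source_condition_error\<close>). The powers of \<open>|A|\<close> are limits of polynomials, and the heart of the matter
is that for a positive operator \<open>S\<close> and a polynomial \<open>P\<close> nonnegative on \<open>[0, \<parallel>S\<parallel>]\<close> the operator \<open>P(S)\<close>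
is positive as well (\<open>operator_poly_nonneg\<close>): otherwise some \<open>P(S) - m\<close> with \<open>m < 0\<close> would have approximate
null vectors, although \<open>P - m\<close> splits into factors that are bounded below at \<open>S\<close>. Thus the inequality
\<open>t\<^bsup>p\<^esup> \<le> a\<^bsup>p/2-1\<^esup> (a + t\<^sup>2)\<close> for numbers, \<open>0 < p \<le> 2\<close>, carries over to \<open>|A|\<close>. Balancing \<open>a\<^bsup>p/2\<^esup> \<rho>\<close>
against the noise term \<open>\<delta> / sqrt a\<close> gives the rate.
\<close>

section \<open>The resolvent of the normal operator\<close>

text \<open>The energy \<open>J\<close> below is strictly convex with modulus \<open>a\<close>, so the parallelogram law makes every
minimising sequence Cauchy, and the Euler equation of the minimiser is the claimed identity. With
\<open>A = 0\<close> this is the Riesz representation theorem; with \<open>\<phi> = inner g\<close> it solves the normal equation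
\<open>(a + A\<^sup>* A) u = g\<close>.\<close>

lemma coercive_weak_solution:
  fixes A :: "'h::{real_inner,complete_space} \<Rightarrow> 'f::real_inner" and \<phi> :: "'h \<Rightarrow> real"
  assumes A: "bounded_linear A" and \<phi>: "bounded_linear \<phi>" and a: "0 < a"
  shows "\<exists>u. \<forall>x. a * inner u x + inner (A u) (A x) = \<phi> x"
proof -
  interpret A: bounded_linear A by (rule A)
  interpret p: bounded_linear \<phi> by (rule \<phi>)
  define J where "J x = a * (x \<bullet> x) + A x \<bullet> A x - 2 * \<phi> x" for x
  obtain K where K: "\<And>x. \<bar>\<phi> x\<bar> \<le> norm x * K" and K0: "0 < K"
    using p.pos_bounded by (auto simp: real_norm_def)
  have lower: "- (K\<^sup>2 / a) \<le> J x" for x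
  proof -
    have "0 \<le> (a * norm x - K)\<^sup>2 / a" using a by simp
    also have "\<dots> = a * (x \<bullet> x) - 2 * (norm x * K) + K\<^sup>2 / a"
      using a by (simp add: power2_eq_square field_simps dot_square_norm)
    also have "\<dots> \<le> a * (x \<bullet> x) - 2 * \<phi> x + K\<^sup>2 / a" using K[of x] by simp
    also have "\<dots> \<le> J x + K\<^sup>2 / a" unfolding J_def by simp
    finally show ?thesis by simp
  qed
  define d where "d = Inf (range J)"
  have bdd: "bdd_below (range J)" using lower by (intro bdd_belowI2) auto
  have d: "d \<le> J x" for x unfolding d_def by (intro cInf_lower bdd) auto
  have "\<exists>x. J x < d + 1 / real (Suc n)" for n
  proof -
    have "Inf (range J) < d + 1 / real (Suc n)" unfolding d_def by simp
    then show ?thesis using cInf_less_iff[OF _ bdd] by auto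
  qed
  then obtain X where X: "\<And>n. J (X n) < d + 1 / real (Suc n)" by metis
  have mid: "a * (norm (x - y))\<^sup>2 \<le> 2 * (J x - d) + 2 * (J y - d)" for x y
  proof -
    have "4 * J ((1/2) *\<^sub>R (x + y)) = 2 * J x + 2 * J y - (a * ((x - y) \<bullet> (x - y)) + A (x - y) \<bullet> A (x - y))"
      unfolding J_def
      by (simp add: A.scaleR A.add A.diff p.scaleR p.add p.diff algebra_simps inner_commute)
    moreover have "4 * d \<le> 4 * J ((1/2) *\<^sub>R (x + y))" using d by simp
    moreover have "0 \<le> A (x - y) \<bullet> A (x - y)" by simp
    moreover define p r where "p = a * ((x - y) \<bullet> (x - y))" and "r = A (x - y) \<bullet> A (x - y)"
    ultimately have "p \<le> 2 * (J x - d) + 2 * (J y - d)" by argo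
    then show ?thesis by (simp add: power2_norm_eq_inner p_def)
  qed
  have "Cauchy X"
  proof (rule metric_CauchyI)
    fix e :: real assume e: "0 < e"
    obtain N where N: "4 / (a * e\<^sup>2) < real N" using reals_Archimedean2 by blast
    show "\<exists>N. \<forall>m\<ge>N. \<forall>n\<ge>N. dist (X m) (X n) < e"
    proof (intro exI allI impI)
      fix m n assume mn: "N \<le> m" "N \<le> n"
      have sm: "2 * (J (X k) - d) < a * e\<^sup>2 / 2" if "N \<le> k" for k
      proof -
        have "4 / (a * e\<^sup>2) < real (Suc k)" using N that by simp
        then have "1 / real (Suc k) < a * e\<^sup>2 / 4" using a e by (simp add: field_simps)
        then show ?thesis using X[of k] by argo
      qed
      have "a * (norm (X m - X n))\<^sup>2 < a * e\<^sup>2"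
        using mid[of "X m" "X n"] sm[OF mn(1)] sm[OF mn(2)] by argo
      then have "(norm (X m - X n))\<^sup>2 < e\<^sup>2" using a by simp
      then show "dist (X m) (X n) < e"
        using e by (simp add: dist_norm power_less_imp_less_base)
    qed
  qed
  then obtain u where u: "X \<longlonglongrightarrow> u" using Cauchy_convergent convergent_def by blast
  have "(\<lambda>n. J (X n)) \<longlonglongrightarrow> J u" unfolding J_def
    by (intro tendsto_intros u A.tendsto p.tendsto)
  moreover have "(\<lambda>n. d + 1 / real (Suc n)) \<longlonglongrightarrow> d"
    using tendsto_add[OF tendsto_const[of d] LIMSEQ_inverse_real_of_nat] by (simp add: inverse_eq_divide)
  ultimately have Ju: "J u \<le> d"
    using X by (intro LIMSEQ_le[where X="\<lambda>n. J (X n)"]) (auto intro: less_imp_le)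
  have "a * inner u x + inner (A u) (A x) = \<phi> x" for x
  proof -
    define c where "c = a * inner u x + inner (A u) (A x) - \<phi> x"
    define s where "s = a * (x \<bullet> x) + A x \<bullet> A x + 1"
    \<comment> \<open>the displacement along \<open>x\<close> that would lower \<open>J\<close> if the residual \<open>c\<close> were nonzero; the \<open>1\<close> in \<open>s\<close> only avoids a zero denominator\<close>
    define t where "t = - c / s"
    have s: "1 \<le> s" unfolding s_def using a by simp
    have "J (u + t *\<^sub>R x) = J u + 2 * t * c + t\<^sup>2 * (s - 1)"
      unfolding J_def c_def s_def
      by (simp add: A.scaleR A.add p.scaleR p.add algebra_simps inner_commute power2_eq_square)
    then have "0 \<le> 2 * t * c + t\<^sup>2 * (s - 1)" using d[of "u + t *\<^sub>R x"] Ju by linarith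
    also have "\<dots> = - c\<^sup>2 / s - c\<^sup>2 / s\<^sup>2"
      unfolding t_def using s by (simp add: field_simps power2_eq_square)
    finally have "c\<^sup>2 / s + c\<^sup>2 / s\<^sup>2 \<le> 0" by simp
    moreover have "0 \<le> c\<^sup>2 / s" "0 \<le> c\<^sup>2 / s\<^sup>2" using s by auto
    ultimately have "c\<^sup>2 / s = 0" by linarith
    then show ?thesis using s unfolding c_def by simp
  qed
  then show ?thesis by blast
qed

lemma inner_adjoint:
  fixes A :: "'h::{real_inner,complete_space} \<Rightarrow> 'f::real_inner"
  assumes A: "bounded_linear A"
  shows "inner (A x) y = inner x (adjoint A y)"
proof -
  interpret A: bounded_linear A by (rule A)
  have "\<exists>w. \<forall>x. inner (A x) y = inner x w" for y
  proof -
    have "bounded_linear (\<lambda>x. inner (A x) y)"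
      by (rule bounded_linear_compose[OF bounded_linear_inner_left A])
    from coercive_weak_solution[OF bounded_linear_zero this, of 1]
    obtain w where "\<And>x. inner w x + inner (0::real) 0 = inner (A x) y" by auto
    then show ?thesis by (metis add.right_neutral inner_zero_left inner_commute)
  qed
  then obtain A' where "\<forall>x y. inner (A x) y = inner x (A' y)" by metis
  then have "\<forall>x y. inner (A x) y = inner x (adjoint A y)"
    unfolding adjoint_def by (rule someI[of "\<lambda>f'. \<forall>x y. inner (A x) y = inner x (f' y)"])
  then show ?thesis by blast
qed

lemma inner_left_eqI: "(\<And>x. inner x u = inner x v) \<Longrightarrow> u = v"
  for u v :: "'a::real_inner"
  using vector_eq_ldot[of u v] by blast

lemma bounded_linear_adjoint:
  fixes A :: "'h::{real_inner,complete_space} \<Rightarrow> 'f::real_inner"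
  assumes A: "bounded_linear A"
  shows "bounded_linear (adjoint A)"
proof -
  interpret A: bounded_linear A by (rule A)
  note adj = inner_adjoint[OF A, symmetric]
  show ?thesis
  proof (rule bounded_linear_intro[where K = "onorm A"])
    show "adjoint A (x + y) = adjoint A x + adjoint A y" for x y
      by (rule inner_left_eqI) (simp add: adj inner_right_distrib)
    show "adjoint A (r *\<^sub>R x) = r *\<^sub>R adjoint A x" for r x
      by (rule inner_left_eqI) (simp add: adj)
    fix y
    have "norm (adjoint A y) * norm (adjoint A y) = inner (A (adjoint A y)) y"
      by (simp add: inner_adjoint[OF A] flip: power2_eq_square power2_norm_eq_inner)
    also have "\<dots> \<le> norm (A (adjoint A y)) * norm y" by (rule norm_cauchy_schwarz)
    also have "\<dots> \<le> (onorm A * norm (adjoint A y)) * norm y"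
      by (intro mult_right_mono onorm A) simp
    finally have "norm (adjoint A y) * norm (adjoint A y) \<le> norm (adjoint A y) * (norm y * onorm A)"
      by (simp add: mult_ac)
    then show "norm (adjoint A y) \<le> norm y * onorm A"
      using onorm_pos_le[OF A] by (cases "adjoint A y = 0") auto
  qed
qed

definition positive_operator :: "('h::real_inner \<Rightarrow> 'h) \<Rightarrow> bool" where
  "positive_operator T \<longleftrightarrow> bounded_linear T \<and> (\<forall>x y. inner (T x) y = inner x (T y)) \<and>
     (\<forall>x. 0 \<le> inner (T x) x)"

lemma positive_operatorD:
  assumes "positive_operator T"
  shows "bounded_linear T" and "inner (T x) y = inner x (T y)" and "0 \<le> inner (T x) x"
  using assms unfolding positive_operator_def by blast+

lemma positive_operator_normal:
  fixes A :: "'h::{real_inner,complete_space} \<Rightarrow> 'f::{real_inner,complete_space}"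
  assumes A: "bounded_linear A"
  shows "positive_operator (\<lambda>x. adjoint A (A x))"
  unfolding positive_operator_def
proof (intro conjI allI)
  show "bounded_linear (\<lambda>x. adjoint A (A x))"
    by (rule bounded_linear_compose[OF bounded_linear_adjoint[OF A] A])
  have sq: "inner (adjoint A (A x)) y = inner (A x) (A y)" for x y
    by (metis inner_adjoint[OF A] inner_commute)
  show "inner (adjoint A (A x)) y = inner x (adjoint A (A y))" for x y
    unfolding sq by (rule inner_adjoint[OF A])
  show "0 \<le> inner (adjoint A (A x)) x" for x unfolding sq by simp
qed

text \<open>All mixed terms in the expansion of the squared norm are nonnegative because \<open>T\<close> is. At
\<open>x = R\<^sub>a y\<close> it says that \<open>a R\<^sub>a\<close> and \<open>T R\<^sub>a\<close> are contractions, and at \<open>x = R\<^sub>a R\<^sub>b y\<close> it compares the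
resolvents for two parameters.\<close>

lemma norm_positive_combination_mono:
  assumes T: "positive_operator T" and "0 \<le> a" "a \<le> a'" "0 \<le> s" "s \<le> s'"
  shows "norm (a *\<^sub>R x + s *\<^sub>R T x) \<le> norm (a' *\<^sub>R x + s' *\<^sub>R T x)"
proof -
  have sym: "inner x (T x) = inner (T x) x" by (rule inner_commute)
  have eq: "(norm (a *\<^sub>R x + s *\<^sub>R T x))\<^sup>2 = a\<^sup>2 * (norm x)\<^sup>2 + 2 * (a * s) * inner (T x) x + s\<^sup>2 * (norm (T x))\<^sup>2"
    for a s unfolding power2_norm_eq_inner
    by (simp add: inner_add_left inner_add_right sym power2_eq_square algebra_simps)
  have "(norm (a *\<^sub>R x + s *\<^sub>R T x))\<^sup>2 \<le> (norm (a' *\<^sub>R x + s' *\<^sub>R T x))\<^sup>2"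
    unfolding eq using assms unfolding positive_operator_def
    by (intro add_mono mult_mono power_mono) auto
  then show ?thesis by (rule power2_le_imp_le) simp
qed

definition resolvent :: "('h::real_inner \<Rightarrow> 'f::real_inner) \<Rightarrow> real \<Rightarrow> 'h \<Rightarrow> 'h" where
  "resolvent A a = inv (\<lambda>u. a *\<^sub>R u + adjoint A (A u))"

lemma tikhonov_resolvent: "tikhonov A g a = resolvent A a (adjoint A g)"
  by (simp add: tikhonov_def resolvent_def)

context
  fixes A :: "'h::{real_inner,complete_space} \<Rightarrow> 'f::{real_inner,complete_space}"
  assumes A: "bounded_linear A"
begin

interpretation A: bounded_linear A by (rule A)
interpretation A': bounded_linear "adjoint A" by (rule bounded_linear_adjoint[OF A])

private abbreviation (input) "T x \<equiv> adjoint A (A x)"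
private abbreviation (input) "R \<equiv> resolvent A"

lemma resolvent_unique:
  assumes a: "0 < a" and "a *\<^sub>R x + T x = y"
  shows "R a y = x"
proof -
  have "inj (\<lambda>u. a *\<^sub>R u + T u)"
  proof (rule injI)
    fix u v assume "a *\<^sub>R u + T u = a *\<^sub>R v + T v"
    then have z: "a *\<^sub>R (u - v) + T (u - v) = 0"
      by (simp add: A.diff A'.diff algebra_simps)
    have "norm (a *\<^sub>R (u - v) + 0 *\<^sub>R T (u - v)) \<le> norm (a *\<^sub>R (u - v) + 1 *\<^sub>R T (u - v))"
      using a by (intro norm_positive_combination_mono[OF positive_operator_normal[OF A]]) auto
    then show "u = v" using z a by (simp add: mult_le_0_iff)
  qed
  from inv_f_f[OF this, of x] show ?thesis by (simp add: resolvent_def assms(2))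
qed

lemma resolvent_solves:
  assumes a: "0 < a"
  shows "a *\<^sub>R R a y + T (R a y) = y"
proof -
  from coercive_weak_solution[OF A bounded_linear_inner_left[of y] a]
  obtain u where "\<And>x. a * inner u x + inner (A u) (A x) = inner x y" by blast
  note u = this
  have "inner x (a *\<^sub>R u + T u) = inner x y" for x
    using u[of x] inner_adjoint[OF A, of x "A u"] inner_commute[of u x] inner_commute[of "A u" "A x"]
    by (simp add: inner_add_right)
  then have "a *\<^sub>R u + T u = y" by (rule inner_left_eqI)
  with resolvent_unique[OF a this] show ?thesis by simp
qed

lemma resolvent_commutes:
  assumes a: "0 < a" and S: "linear S" and comm: "\<And>x. S (T x) = T (S x)"
  shows "S (R a y) = R a (S y)"
proof -
  have "a *\<^sub>R S (R a y) + T (S (R a y)) = S (a *\<^sub>R R a y + T (R a y))"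
    by (simp only: linear_add[OF S] linear_cmul[OF S] comm)
  then have "R a (S y) = S (R a y)"
    by (intro resolvent_unique[OF a]) (simp only: resolvent_solves[OF a])
  then show ?thesis by simp
qed

lemma linear_resolvent:
  assumes a: "0 < a" shows "linear (R a)"
proof (rule linearI)
  fix x y and r :: real
  have "a *\<^sub>R (R a x + R a y) + T (R a x + R a y) = (a *\<^sub>R R a x + T (R a x)) + (a *\<^sub>R R a y + T (R a y))"
    by (simp add: A.add A'.add algebra_simps)
  then show "R a (x + y) = R a x + R a y"
    by (intro resolvent_unique[OF a]) (simp only: resolvent_solves[OF a])
  have "a *\<^sub>R (r *\<^sub>R R a x) + T (r *\<^sub>R R a x) = r *\<^sub>R (a *\<^sub>R R a x + T (R a x))"
    by (simp add: A.scaleR A'.scaleR algebra_simps)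
  then show "R a (r *\<^sub>R x) = r *\<^sub>R R a x"
    by (intro resolvent_unique[OF a]) (simp only: resolvent_solves[OF a])
qed

lemma resolvent_normal_commute: "0 < a \<Longrightarrow> T (R a y) = R a (T y)"
  by (rule resolvent_commutes) (auto intro: linear_compose[unfolded o_def] A.linear A'.linear)

lemma resolvent_commute: "0 < a \<Longrightarrow> 0 < b \<Longrightarrow> R b (R a y) = R a (R b y)"
  by (rule resolvent_commutes) (auto simp: linear_resolvent resolvent_normal_commute)

lemma norm_resolvent_antimono:
  assumes "0 < a" "a \<le> b" shows "norm (R b y) \<le> norm (R a y)"
proof -
  define z where "z = R a (R b y)"
  have "R b y = a *\<^sub>R z + 1 *\<^sub>R T z" "R a y = b *\<^sub>R z + 1 *\<^sub>R T z"
    using assms resolvent_solves[of a "R b y"] resolvent_solves[of b "R a y"] 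
      resolvent_commute[of a b y] by (auto simp: z_def)
  then show ?thesis
    using norm_positive_combination_mono[OF positive_operator_normal[OF A], of a b 1 1 z] assms by simp
qed

lemma norm_scaled_resolvent_mono:
  assumes "0 < a" "a \<le> b" shows "a * norm (R a y) \<le> b * norm (R b y)"
proof -
  define z where "z = R a (R b y)"
  have "R b y = a *\<^sub>R z + T z" "R a y = b *\<^sub>R z + T z"
    using assms resolvent_solves[of a "R b y"] resolvent_solves[of b "R a y"] 
      resolvent_commute[of a b y] by (auto simp: z_def)
  then have "b *\<^sub>R R b y = (a * b) *\<^sub>R z + b *\<^sub>R T z" "a *\<^sub>R R a y = (a * b) *\<^sub>R z + a *\<^sub>R T z"
    by (simp_all add: algebra_simps)
  then have "norm (a *\<^sub>R R a y) \<le> norm (b *\<^sub>R R b y)"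
    using norm_positive_combination_mono[OF positive_operator_normal[OF A], of "a*b" "a*b" a b z] assms by simp
  then show ?thesis using assms by simp
qed

lemma norm_scaled_resolvent_le: "0 < a \<Longrightarrow> a * norm (R a y) \<le> norm y"
  using norm_positive_combination_mono[OF positive_operator_normal[OF A], of a a 0 1 "R a y"]
    resolvent_solves[of a y] by simp

lemma norm_normal_resolvent_le: "0 < a \<Longrightarrow> norm (T (R a y)) \<le> norm y"
  using norm_positive_combination_mono[OF positive_operator_normal[OF A], of 0 a 1 1 "R a y"]
    resolvent_solves[of a y] by simp

lemma norm_resolvent_adjoint_le:
  assumes a: "0 < a" shows "norm (R a (adjoint A g)) \<le> norm g / sqrt a"
proof -
  define x where "x = R a (adjoint A g)"
  have "a * (x \<bullet> x) + A x \<bullet> A x = A x \<bullet> g"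
    using arg_cong[OF resolvent_solves[OF a, of "adjoint A g"], of "inner x"]
    by (simp add: x_def[symmetric] inner_right_distrib inner_adjoint[OF A, symmetric])
  moreover have "0 \<le> (g - A x) \<bullet> (g - A x)" by simp
  moreover have "(g - A x) \<bullet> (g - A x) = g \<bullet> g - 2 * (A x \<bullet> g) + A x \<bullet> A x"
    by (simp add: algebra_simps inner_commute)
  ultimately have "a * (x \<bullet> x) \<le> g \<bullet> g" 
    using inner_ge_zero[of g] inner_ge_zero[of "A x"] by linarith
  then have "(sqrt a * norm x)\<^sup>2 \<le> (norm g)\<^sup>2"
    using a by (simp add: power_mult_distrib power2_norm_eq_inner)
  then have "sqrt a * norm x \<le> norm g" by (rule power2_le_imp_le) simp
  then show ?thesis using a by (simp add: x_def field_simps)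
qed

text \<open>The resolvent identity. It yields the derivative of \<open>a \<mapsto> R\<^sub>a y\<close> and measures the change of the
Tikhonov approximation between neighbouring grid points.\<close>

lemma resolvent_diff:
  assumes a: "0 < a" and b: "0 < b"
  shows "R b y - R a y = (a - b) *\<^sub>R R b (R a y)"
proof -
  have "y - (b *\<^sub>R R a y + T (R a y)) = (a - b) *\<^sub>R R a y"
    using resolvent_solves[OF a, of y] by (simp add: algebra_simps)
  then have "R b (y - (b *\<^sub>R R a y + T (R a y))) = (a - b) *\<^sub>R R b (R a y)"
    by (simp add: linear_cmul[OF linear_resolvent[OF b]])
  then show ?thesis
    using resolvent_unique[OF b refl, of "R a y"] by (simp add: linear_diff[OF linear_resolvent[OF b]])
qed

lemma tendsto_resolvent:
  assumes a: "0 < a"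
  shows "((\<lambda>b. R b y) \<longlongrightarrow> R a y) (at a)"
proof -
  have "((\<lambda>b. \<bar>a - b\<bar> * (norm (R a y) / b)) \<longlongrightarrow> \<bar>a - a\<bar> * (norm (R a y) / a)) (at a)"
    using a by (intro tendsto_intros) auto
  then have lim: "((\<lambda>b. \<bar>a - b\<bar> * (norm (R a y) / b)) \<longlongrightarrow> 0) (at a)" by simp
  have "\<forall>\<^sub>F b in at a. 0 < b" by (rule order_tendstoD(1)[OF tendsto_ident_at a])
  then have "\<forall>\<^sub>F b in at a. norm (R b y - R a y) \<le> \<bar>a - b\<bar> * (norm (R a y) / b)"
  proof eventually_elim
    case (elim b)
    have "norm (R b (R a y)) \<le> norm (R a y) / b"
      using norm_scaled_resolvent_le[OF elim, of "R a y"] elim by (simp add: field_simps)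
    then show ?case unfolding resolvent_diff[OF a elim] norm_scaleR
      by (intro mult_left_mono) auto
  qed
  then have "((\<lambda>b. R b y - R a y) \<longlongrightarrow> 0) (at a)"
    using lim by (rule Lim_null_comparison)
  then show ?thesis by (simp add: LIM_zero_iff)
qed

section \<open>The quasi-optimality function\<close>

lemma has_vector_derivative_tikhonov:
  assumes a: "0 < a"
  shows "(tikhonov A g has_vector_derivative - R a (tikhonov A g a)) (at a)"
  unfolding has_vector_derivative_def
proof (rule has_derivativeI_sandwich[OF a])
  define w where "w = tikhonov A g a"
  show "bounded_linear (\<lambda>t. t *\<^sub>R - R a (tikhonov A g a))" by (rule bounded_linear_scaleR_left)
  show "norm (tikhonov A g b - tikhonov A g a - (b - a) *\<^sub>R - R a (tikhonov A g a)) / norm (b - a)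
      \<le> norm (R b w - R a w)" if "b \<noteq> a" "dist b a < a" for b
  proof -
    have b: "0 < b" using that by (auto simp: dist_real_def)
    \<comment> \<open>the difference quotient is \<open>- R\<^sub>b w\<close>, which tends to \<open>- R\<^sub>a w\<close>\<close>
    have "tikhonov A g b - w - (b - a) *\<^sub>R - R a w = (a - b) *\<^sub>R (R b w - R a w)"
      using resolvent_diff[OF a b, of "adjoint A g"]
      by (simp add: w_def tikhonov_resolvent algebra_simps)
    then show ?thesis using that by (simp add: w_def abs_minus_commute)
  qed
  show "((\<lambda>b. norm (R b w - R a w)) \<longlongrightarrow> 0) (at a)"
    using tendsto_resolvent[OF a, of w] by (intro tendsto_norm_zero) (simp add: LIM_zero)
qed

lemma psiQ_resolvent:
  assumes a: "0 < a"
  shows "psiQ A g a = a * norm (R a (R a (adjoint A g)))"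
  using vector_derivative_at[OF has_vector_derivative_tikhonov[OF a]]
  by (simp add: psiQ_def tikhonov_resolvent)

lemma psiQ_nonneg: "0 < a \<Longrightarrow> 0 \<le> psiQ A g a"
  by (simp add: psiQ_resolvent)

text \<open>\<open>R\<^sub>a\<close> is injective, so a zero of \<open>\<psi>\<^sub>Q\<close> forces \<open>A\<^sup>* g = 0\<close>. This handles the values of
\<open>T_quot\<close> with denominator zero.\<close>

lemma tikhonov_zero_if_psiQ_zero:
  assumes a: "0 < a" and b: "0 < b" and "psiQ A g a = 0"
  shows "tikhonov A g b = 0"
proof -
  have zero: "R c 0 = 0" if "0 < c" for c by (rule linear_0[OF linear_resolvent[OF that]])
  have inj: "y = 0" if "R a y = 0" for y using resolvent_solves[OF a, of y] that by (simp add: A.zero A'.zero)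
  have "R a (R a (adjoint A g)) = 0" using assms by (simp add: psiQ_resolvent)
  then have "adjoint A g = 0" using inj by blast
  then show ?thesis by (simp add: tikhonov_resolvent zero b)
qed

text \<open>By the resolvent identity the step is \<open>(a - b) R\<^sub>b R\<^sub>a A\<^sup>* g\<close>; monotonicity in the parameter replaces one
of the two resolvents by the other, in either direction.\<close>

lemma norm_tikhonov_step_le:
  assumes b: "0 < b" and "b \<le> a"
  shows "norm (tikhonov A g b - tikhonov A g a) \<le> (a / b - 1) * psiQ A g a"
    and "norm (tikhonov A g b - tikhonov A g a) \<le> (a / b - 1) * psiQ A g b"
proof -
  have a: "0 < a" using assms by simp
  define y where "y = adjoint A g"
  have eq: "norm (tikhonov A g b - tikhonov A g a) = (a - b) * norm (R b (R a y))"
    using resolvent_diff[OF a b] assms by (simp add: y_def tikhonov_resolvent)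
  have step: "norm (tikhonov A g b - tikhonov A g a) \<le> (a / b - 1) * c"
    if "b * norm (R b (R a y)) \<le> c" for c
  proof -
    have "(a - b) * norm (R b (R a y)) = (a / b - 1) * (b * norm (R b (R a y)))"
      using b by (simp add: field_simps)
    also have "\<dots> \<le> (a / b - 1) * c" using that assms by (intro mult_left_mono) auto
    finally show ?thesis by (simp add: eq)
  qed
  show "norm (tikhonov A g b - tikhonov A g a) \<le> (a / b - 1) * psiQ A g a"
    using norm_scaled_resolvent_mono[OF assms] by (intro step) (simp add: psiQ_resolvent a y_def)
  show "norm (tikhonov A g b - tikhonov A g a) \<le> (a / b - 1) * psiQ A g b"
    using norm_resolvent_antimono[OF assms, of "R b y"] b resolvent_commute[OF a b]
    by (intro step) (simp add: psiQ_resolvent y_def)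
qed

lemma tikhonov_exact_error:
  assumes a: "0 < a"
  shows "tikhonov A (A u) a - u = - (a *\<^sub>R R a u)"
proof -
  have "tikhonov A (A u) a = T (R a u)"
    by (simp add: tikhonov_resolvent resolvent_normal_commute[OF a])
  then show ?thesis using resolvent_solves[OF a, of u] by (simp add: algebra_simps)
qed

lemma e1_resolvent:
  assumes a: "0 < a"
  shows "e1 A (A u) f u a = a * norm (R a u) + norm (R a (adjoint A (f - A u)))"
  unfolding e1_def tikhonov_exact_error[OF a] using a
  by (simp add: tikhonov_resolvent linear_diff[OF linear_resolvent[OF a]] A'.diff)

lemma error_le_e1:
  "norm (tikhonov A f a - u) \<le> e1 A (A u) f u a"
  unfolding e1_def using norm_triangle_ineq[of "tikhonov A f a - tikhonov A (A u) a" "tikhonov A (A u) a - u"]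
  by simp

text \<open>Split \<open>A\<^sup>* f = A\<^sup>* (f - A u) + T u\<close>. One resolvent of \<open>a R\<^sub>a\<^sup>2\<close> is spent on contracting: \<open>a R\<^sub>a\<close> on the
noise part and \<open>T R\<^sub>a\<close> on the exact part, and what remains are the two summands of \<open>e\<^sub>1\<close>.\<close>

lemma psiQ_le_e1:
  assumes a: "0 < a"
  shows "psiQ A f a \<le> e1 A (A u) f u a"
proof -
  note lin = linear_add[OF linear_resolvent[OF a]] linear_cmul[OF linear_resolvent[OF a]]
  define h where "h = R a (adjoint A (f - A u))"
  have "adjoint A f = adjoint A (f - A u) + T u" by (simp add: A'.diff)
  then have "R a (R a (adjoint A f)) = R a h + T (R a (R a u))"
    by (simp add: lin h_def resolvent_normal_commute[OF a])
  then have "psiQ A f a \<le> a * (norm (R a h) + norm (T (R a (R a u))))"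
    using a by (simp add: psiQ_resolvent norm_triangle_ineq)
  also have "\<dots> \<le> norm h + a * norm (R a u)"
    using norm_scaled_resolvent_le[OF a, of h] norm_normal_resolvent_le[OF a, of "R a u"] a
    by (simp add: distrib_left add_mono)
  finally show ?thesis by (simp add: e1_resolvent[OF a] h_def)
qed

text \<open>The noise part of \<open>e\<^sub>1\<close> decreases in the parameter and the approximation part grows at most linearly.\<close>

lemma e1_le_scaled:
  assumes "0 < a" "a \<le> b"
  shows "e1 A (A u) f u b \<le> (b / a) * e1 A (A u) f u a"
proof -
  have b: "0 < b" using assms by simp
  have "norm (R b y) \<le> 1 * norm (R a y)" for y using norm_resolvent_antimono[OF assms] by simp
  moreover have "1 * norm (R a y) \<le> (b / a) * norm (R a y)" for y
    using assms by (intro mult_right_mono) auto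
  moreover have "b * norm (R b u) \<le> (b / a) * (a * norm (R a u))"
    using norm_resolvent_antimono[OF assms, of u] assms by simp
  ultimately show ?thesis
    unfolding e1_resolvent[OF assms(1)] e1_resolvent[OF b] distrib_left by (meson add_mono order_trans)
qed

end

section \<open>Polynomials of an operator\<close>

lemma operator_poly_0: "operator_poly 0 T x = 0"
  by (simp add: operator_poly_def)

lemma operator_poly_const: "operator_poly [:c:] T x = c *\<^sub>R x"
  by (simp add: operator_poly_def)

context
  fixes T :: "'h::real_inner \<Rightarrow> 'h"
  assumes T: "bounded_linear T"
begin

interpretation T: bounded_linear T by (rule T)

lemma operator_poly_sum:
  assumes "degree P \<le> n"
  shows "operator_poly P T x = (\<Sum>i\<le>n. coeff P i *\<^sub>R (T ^^ i) x)"
  unfolding operator_poly_def using assms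
  by (intro sum.mono_neutral_left) (auto simp: coeff_eq_0)

lemma operator_poly_pCons:
  "operator_poly (pCons a P) T x = a *\<^sub>R x + T (operator_poly P T x)"
proof -
  have "operator_poly (pCons a P) T x = (\<Sum>i\<le>Suc (degree P). coeff (pCons a P) i *\<^sub>R (T ^^ i) x)"
    by (rule operator_poly_sum) (simp add: degree_pCons_le)
  also have "\<dots> = a *\<^sub>R x + (\<Sum>i\<le>degree P. coeff P i *\<^sub>R T ((T ^^ i) x))"
    by (subst sum.atMost_Suc_shift) simp
  finally show ?thesis by (simp add: operator_poly_def T.sum T.scaleR)
qed

lemma linear_operator_poly: "linear (operator_poly P T)"
proof (induction P)
  case 0
  show ?case by (simp add: operator_poly_0 linear_iff)
next
  case (pCons a P)
  then show ?case by (simp add: operator_poly_pCons linear_iff T.add T.scaleR algebra_simps)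
qed

lemma operator_poly_add: "operator_poly (P + Q) T x = operator_poly P T x + operator_poly Q T x"
proof (induction P arbitrary: Q)
  case 0
  show ?case by (simp add: operator_poly_0)
next
  case (pCons a P)
  then show ?case by (cases Q) (simp add: operator_poly_pCons T.add algebra_simps)
qed

lemma operator_poly_smult: "operator_poly (smult c P) T x = c *\<^sub>R operator_poly P T x"
  by (induction P) (simp_all add: operator_poly_0 operator_poly_pCons T.scaleR algebra_simps)

lemma operator_poly_diff: "operator_poly (P - Q) T x = operator_poly P T x - operator_poly Q T x"
  using operator_poly_add[of P "smult (-1) Q" x] operator_poly_smult[of "-1" Q x] by simp

lemma operator_poly_mult: "operator_poly (P * Q) T x = operator_poly P T (operator_poly Q T x)"
  by (induction P) (simp_all add: operator_poly_0 operator_poly_pCons operator_poly_add operator_poly_smult)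

lemma bounded_linear_operator_poly: "bounded_linear (operator_poly P T)"
proof (induction P)
  case 0
  show ?case by (simp add: operator_poly_0[abs_def])
next
  case (pCons a P)
  show ?case unfolding operator_poly_pCons[abs_def]
    by (intro bounded_linear_add bounded_linear_scaleR_right bounded_linear_compose[OF T pCons(2)])
qed

lemma operator_poly_commutes:
  assumes "linear S" "\<And>x. S (T x) = T (S x)"
  shows "S (operator_poly P T x) = operator_poly P T (S x)"
  by (induction P) (simp_all add: operator_poly_0 operator_poly_pCons
     linear_add[OF assms(1)] linear_cmul[OF assms(1)] linear_0[OF assms(1)] assms(2))

end

text \<open>Over the reals a nonconstant polynomial has a factor \<open>t - r\<close> or, from a nonreal complex root
\<open>b + i c\<close>, a factor \<open>(t - b)\<^sup>2 + c\<^sup>2\<close>. The second form is kept unexpanded because it is visibly bounded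
below at a symmetric operator.\<close>

lemma real_poly_factor_induct [consumes 1, case_names const linear quadratic]:
  fixes P :: "real poly"
  assumes P: "P \<noteq> 0"
    and const: "\<And>c. c \<noteq> 0 \<Longrightarrow> H [:c:]"
    and linear: "\<And>r P. P \<noteq> 0 \<Longrightarrow> H P \<Longrightarrow> H ([:- r, 1:] * P)"
    and quadratic: "\<And>b c P. P \<noteq> 0 \<Longrightarrow> c \<noteq> 0 \<Longrightarrow> H P \<Longrightarrow> H (([:- b, 1:] * [:- b, 1:] + [:c\<^sup>2:]) * P)"
  shows "H P"
  using P
proof (induction "degree P" arbitrary: P rule: less_induct)
  case less
  show ?case
  proof (cases "degree P = 0")
    case True
    then obtain c where "P = [:c:]" by (rule degree_eq_zeroE)
    then show ?thesis using const less.prems by auto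
  next
    case False
    let ?C = "map_poly complex_of_real"
    have "degree (?C P) \<noteq> 0" using False by (simp add: degree_map_poly)
    then have "\<not> constant (poly (?C P))" by (simp add: constant_degree)
    then obtain z where z: "poly (?C P) z = 0" using fundamental_theorem_of_algebra by blast
    have C: "poly (?C (X * Y + Z)) z = poly (?C X) z * poly (?C Y) z + poly (?C Z) z" for X Y Z
    proof -
      have "?C (X * Y + Z) = ?C X * ?C Y + ?C Z"
        by (rule poly_eqI) (simp add: coeff_map_poly coeff_mult)
      then show ?thesis by simp
    qed
    define b c where "b = Re z" and "c = Im z"
    show ?thesis
    proof (cases "c = 0")
      case True
      then have "z = of_real b" by (simp add: b_def c_def complex_eq_iff)
      moreover have "poly (?C P) (of_real b) = of_real (poly P b)"
        by (induction P) (simp_all add: map_poly_pCons)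
      ultimately have "poly P b = 0" using z by simp
      then obtain Q where Q: "P = [:- b, 1:] * Q" using poly_eq_0_iff_dvd by (blast elim: dvdE)
      moreover have "Q \<noteq> 0" using Q less.prems by auto
      moreover have "degree P = degree Q + 1"
        unfolding Q using \<open>Q \<noteq> 0\<close> by (subst degree_mult_eq) auto
      ultimately show ?thesis using linear less.hyps[of Q] by simp
    next
      case False
      define D where "D = [:- b, 1:] * [:- b, 1:] + [:c\<^sup>2:]"
      have D: "D = [:b\<^sup>2 + c\<^sup>2, - 2 * b, 1:]" by (simp add: D_def power2_eq_square)
      have degD: "degree D = 2" by (simp add: D)
      have Dz: "poly (?C D) z = 0"
        by (simp add: D map_poly_pCons complex_eq_iff b_def c_def power2_eq_square algebra_simps)
      define Q S where "Q = P div D" and "S = P mod D"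
      have PQS: "P = Q * D + S" by (simp add: Q_def S_def)
      have "D \<noteq> 0" by (simp add: D)
      then have "degree S < 2 \<or> S = 0" using degree_mod_less[of D P] degD by (auto simp: S_def)
      then have "degree S \<le> 1" by auto
      then have "S = [:coeff S 0, coeff S 1:]"
        by (intro poly_eqI) (auto simp: coeff_pCons coeff_eq_0 split: nat.splits)
      then obtain s t where S: "S = [:s, t:]" by blast
      have "poly (?C S) z = 0" using z Dz C[of Q D S] PQS by simp
      then have "of_real s + z * of_real t = 0"
        by (simp add: S map_poly_pCons)
      \<comment> \<open>the remainder is real, of degree at most 1, and vanishes at a nonreal point\<close>
      then have "S = 0" using False by (auto simp: S complex_eq_iff c_def)
      then have PD: "P = D * Q" using PQS by (simp add: mult.commute)
      moreover have "Q \<noteq> 0" using PD less.prems by auto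
      moreover have "degree P = degree Q + 2"
        unfolding PD using \<open>Q \<noteq> 0\<close> \<open>D \<noteq> 0\<close> degD by (subst degree_mult_eq) auto
      ultimately show ?thesis using quadratic[OF _ False] less.hyps[of Q] by (simp add: D_def)
    qed
  qed
qed

section \<open>Positivity of polynomials of a positive operator\<close>

context
  fixes T :: "'h::{real_inner,complete_space} \<Rightarrow> 'h"
  assumes T: "positive_operator T"
begin

private lemmas bl = positive_operatorD(1)[OF T]
private lemmas sym = positive_operatorD(2)[OF T]
private lemmas pos = positive_operatorD(3)[OF T]

interpretation T: bounded_linear T by (rule bl)
private abbreviation (input) "Op P \<equiv> operator_poly P T"

lemma operator_poly_symmetric: "inner (Op P x) y = inner x (Op P y)"
proof (induction P arbitrary: x y)
  case 0
  show ?case by (simp add: operator_poly_0)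
next
  case (pCons a P)
  have "inner (T (Op P x)) y = inner x (T (Op P y))"
    by (simp add: sym pCons(2) operator_poly_commutes[OF bl T.linear])
  then show ?case by (simp add: operator_poly_pCons[OF bl] inner_add_left inner_add_right)
qed

text \<open>The spectrum of \<open>T\<close> lies in \<open>[0, \<parallel>T\<parallel>]\<close>. Factor by factor: \<open>T - r\<close> is bounded below
for real \<open>r\<close> outside this interval, and \<open>(T - b)\<^sup>2 + c\<^sup>2\<close> is bounded below for \<open>c \<noteq> 0\<close>.\<close>

lemma operator_poly_bounded_below:
  assumes "\<And>t. 0 \<le> t \<Longrightarrow> t \<le> onorm T \<Longrightarrow> poly P t \<noteq> 0"
  shows "\<exists>c>0. \<forall>x. c * norm x \<le> norm (Op P x)"
proof -
  have "P \<noteq> 0" using assms[of 0] onorm_pos_le[OF bl] by auto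
  then show ?thesis using assms
  proof (induction rule: real_poly_factor_induct)
    case (const c)
    then show ?case by (intro exI[of _ "\<bar>c\<bar>"]) (simp add: operator_poly_const)
  next
    case (linear r P)
    have "\<exists>c>0. \<forall>x. c * norm x \<le> norm (Op P x)"
      using linear.prems by (intro linear.IH) auto
    then obtain c where c: "0 < c" "\<And>x. c * norm x \<le> norm (Op P x)" by blast
    have r: "r < 0 \<or> onorm T < r" using linear.prems[of r] by (force simp: not_le)
    define d where "d = max (- r) (r - onorm T)"
    have "0 < d" using r by (auto simp: d_def)
    have "d * norm x \<le> norm (T x - r *\<^sub>R x)" for x
    proof -
      have "d * (norm x)\<^sup>2 \<le> \<bar>inner (T x - r *\<^sub>R x) x\<bar>"
      proof (cases "r < 0")
        case True
        then have "d = - r" using onorm_pos_le[OF bl] by (simp add: d_def)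
        then show ?thesis using pos[of x] by (simp add: power2_norm_eq_inner inner_diff_left)
      next
        case False
        then have "0 < r - onorm T" using r by simp
        then have d: "d = r - onorm T" using onorm_pos_le[OF bl] by (simp add: d_def)
        have "inner (T x) x \<le> norm (T x) * norm x" by (rule norm_cauchy_schwarz)
        also have "\<dots> \<le> (onorm T * norm x) * norm x" by (intro mult_right_mono onorm bl) simp
        finally have "inner (T x) x \<le> onorm T * (x \<bullet> x)"
          by (simp add: power2_eq_square flip: power2_norm_eq_inner)
        then have "d * (x \<bullet> x) \<le> - inner (T x - r *\<^sub>R x) x" by (simp add: d algebra_simps)
        then show ?thesis by (simp add: power2_norm_eq_inner)
      qed
      also have "\<dots> \<le> norm (T x - r *\<^sub>R x) * norm x" by (rule Cauchy_Schwarz_ineq2)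
      finally have "(d * norm x) * norm x \<le> norm (T x - r *\<^sub>R x) * norm x"
        by (simp add: power2_eq_square)
      then show ?thesis by (cases "x = 0") auto
    qed
    moreover have "Op ([:- r, 1:] * P) x = T (Op P x) - r *\<^sub>R Op P x" for x
      by (simp only: operator_poly_mult[OF bl] operator_poly_pCons[OF bl] operator_poly_0) simp
    ultimately have "d * norm (Op P x) \<le> norm (Op ([:- r, 1:] * P) x)" for x by simp
    moreover have "d * c * norm x \<le> d * norm (Op P x)" for x
      using c \<open>0 < d\<close> by simp
    ultimately have "d * c * norm x \<le> norm (Op ([:- r, 1:] * P) x)" for x
      using order_trans by blast
    moreover have "0 < d * c" using c \<open>0 < d\<close> by simp
    ultimately show ?case by blast
  next
    case (quadratic b e P)
    have "poly P t \<noteq> 0" if "0 \<le> t" "t \<le> onorm T" for t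
      using quadratic.prems[OF that] by auto
    then have "\<exists>c>0. \<forall>x. c * norm x \<le> norm (Op P x)" by (intro quadratic.IH) auto
    then obtain c where c: "0 < c" "\<And>x. c * norm x \<le> norm (Op P x)" by blast
    have "e\<^sup>2 * norm x \<le> norm (Op ([:- b, 1:] * [:- b, 1:] + [:e\<^sup>2:]) x)" (is "_ \<le> norm ?y") for x
    proof -
      have "?y = Op [:- b, 1:] (Op [:- b, 1:] x) + e\<^sup>2 *\<^sub>R x"
        by (simp only: operator_poly_mult[OF bl] operator_poly_add[OF bl] operator_poly_const)
      then have "inner ?y x = inner (Op [:- b, 1:] x) (Op [:- b, 1:] x) + e\<^sup>2 * (x \<bullet> x)"
        by (simp only: inner_add_left operator_poly_symmetric inner_scaleR_left)
      then have "e\<^sup>2 * (x \<bullet> x) \<le> inner ?y x" by simp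
      also have "\<dots> \<le> norm ?y * norm x" by (rule norm_cauchy_schwarz)
      finally have "(e\<^sup>2 * norm x) * norm x \<le> norm ?y * norm x"
        by (simp add: power2_eq_square mult.assoc flip: power2_norm_eq_inner)
      then show ?thesis by (cases "x = 0") auto
    qed
    then have "e\<^sup>2 * norm (Op P x) \<le> norm (Op (([:- b, 1:] * [:- b, 1:] + [:e\<^sup>2:]) * P) x)" for x
      by (simp only: operator_poly_mult[OF bl, of _ P])
    moreover have "e\<^sup>2 * c * norm x \<le> e\<^sup>2 * norm (Op P x)" for x
      using c by (simp add: mult_left_mono mult.assoc)
    ultimately have "e\<^sup>2 * c * norm x \<le> norm (Op (([:- b, 1:] * [:- b, 1:] + [:e\<^sup>2:]) * P) x)" for x
      using order_trans by blast
    moreover have "0 < e\<^sup>2 * c" using c \<open>e \<noteq> 0\<close> by simp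
    ultimately show ?case by blast
  qed
qed

text \<open>Let \<open>m\<close> be the infimum of the quadratic form of \<open>P(T)\<close> on the unit sphere. The positive operator
\<open>P(T) - m\<close> has approximate null vectors, namely a minimising sequence. If \<open>m < 0\<close>, then \<open>P - m\<close> has no
zero on \<open>[0, \<parallel>T\<parallel>]\<close>, so \<open>P(T) - m\<close> is bounded below, a contradiction.\<close>

lemma operator_poly_nonneg:
  assumes nonneg: "\<And>t. 0 \<le> t \<Longrightarrow> t \<le> onorm T \<Longrightarrow> 0 \<le> poly P t"
  shows "0 \<le> inner (Op P x) x"
proof (rule ccontr)
  assume "\<not> ?thesis"
  then have neg: "inner (Op P x) x < 0" by simp
  define K where "K = onorm (Op P)"
  have K: "\<bar>inner (Op P y) y\<bar> \<le> K * (norm y)\<^sup>2" for y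
  proof -
    have "\<bar>inner (Op P y) y\<bar> \<le> norm (Op P y) * norm y" by (rule Cauchy_Schwarz_ineq2)
    also have "\<dots> \<le> (K * norm y) * norm y" unfolding K_def
      by (intro mult_right_mono onorm bounded_linear_operator_poly bl) simp
    finally show ?thesis by (simp add: power2_eq_square)
  qed
  define V where "V = (\<lambda>y. inner (Op P y) y) ` sphere 0 1"
  define m where "m = Inf V"
  have bdd: "bdd_below V" unfolding V_def
  proof (rule bdd_belowI2)
    fix y :: 'h assume "y \<in> sphere 0 1"
    then show "- K \<le> inner (Op P y) y" using K[of y] by (simp add: abs_le_iff)
  qed
  have x: "x \<noteq> 0" using neg by auto
  have "inner (Op P (x /\<^sub>R norm x)) (x /\<^sub>R norm x) = inner (Op P x) x / (norm x)\<^sup>2"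
    by (simp add: linear_cmul[OF linear_operator_poly[OF bl]] power2_eq_square divide_inverse)
  moreover have "inner (Op P (x /\<^sub>R norm x)) (x /\<^sub>R norm x) \<in> V"
    unfolding V_def using x by (intro imageI) (simp add: dist_norm)
  ultimately have "m \<le> inner (Op P x) x / (norm x)\<^sup>2" "V \<noteq> {}"
    unfolding m_def using bdd by (auto intro: cInf_lower)
  moreover have "inner (Op P x) x / (norm x)\<^sup>2 < 0" using neg x by (simp add: divide_neg_pos)
  ultimately have m: "m < 0" by simp
  define Q where "Q = P - [:m:]"
  have Q: "Op Q y = Op P y - m *\<^sub>R y" for y
    by (simp add: Q_def operator_poly_diff[OF bl] operator_poly_const)
  have "poly Q t \<noteq> 0" if "0 \<le> t" "t \<le> onorm T" for t
    using nonneg[OF that] m by (simp add: Q_def)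
  then obtain c where c: "0 < c" "\<And>y. c * norm y \<le> norm (Op Q y)"
    using operator_poly_bounded_below by blast
  have Qpos: "0 \<le> inner (Op Q y) y" for y
  proof (cases "y = 0")
    case True
    then show ?thesis by simp
  next
    case False
    have "inner (Op P (y /\<^sub>R norm y)) (y /\<^sub>R norm y) \<in> V"
      unfolding V_def using False by (intro imageI) (simp add: dist_norm)
    then have "m \<le> inner (Op P (y /\<^sub>R norm y)) (y /\<^sub>R norm y)"
      unfolding m_def by (rule cInf_lower[OF _ bdd])
    also have "\<dots> = inner (Op P y) y / (norm y)\<^sup>2"
      by (simp add: linear_cmul[OF linear_operator_poly[OF bl]] power2_eq_square divide_inverse)
    finally show ?thesis using False by (simp add: Q inner_diff_left field_simps flip: power2_norm_eq_inner)
  qed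
  define L where "L = onorm (Op Q) + 1"
  have L: "0 < L" using onorm_pos_le[OF bounded_linear_operator_poly[OF bl, of Q]] by (simp add: L_def)
  \<comment> \<open>evaluate the nonnegative form of \<open>Q(T)\<close> at \<open>y - Q(T) y / L\<close>: a small form forces a small \<open>Q(T) y\<close>\<close>
  have key: "(norm (Op Q y))\<^sup>2 \<le> L * inner (Op Q y) y" for y
  proof -
    define w where "w = Op Q y"
    have "inner (Op Q w) w \<le> norm (Op Q w) * norm w" by (rule norm_cauchy_schwarz)
    also have "\<dots> \<le> (L * norm w) * norm w"
      using onorm[OF bounded_linear_operator_poly[OF bl, of Q], of w]
      by (intro mult_right_mono) (simp_all add: L_def distrib_right add_increasing2)
    finally have le: "inner (Op Q w) w \<le> L * (norm w)\<^sup>2" by (simp add: power2_eq_square)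
    have "Op Q (y - (1/L) *\<^sub>R w) = w - (1/L) *\<^sub>R Op Q w"
      by (simp add: w_def linear_diff[OF linear_operator_poly[OF bl]] linear_cmul[OF linear_operator_poly[OF bl]])
    then have "0 \<le> inner (w - (1/L) *\<^sub>R Op Q w) (y - (1/L) *\<^sub>R w)"
      using Qpos[of "y - (1/L) *\<^sub>R w"] by simp
    also have "\<dots> = inner w y - (2 / L) * (norm w)\<^sup>2 + (1/L)\<^sup>2 * inner (Op Q w) w"
    proof -
      have "inner (Op Q w) y = (norm w)\<^sup>2"
        unfolding power2_norm_eq_inner by (metis operator_poly_symmetric w_def)
      then show ?thesis
        by (simp add: inner_diff_left inner_diff_right power2_eq_square algebra_simps flip: power2_norm_eq_inner)
    qed
    also have "\<dots> \<le> inner w y - (2 / L) * (norm w)\<^sup>2 + (1/L)\<^sup>2 * (L * (norm w)\<^sup>2)"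
      using le by (intro add_left_mono mult_left_mono) auto
    also have "\<dots> = inner w y - (norm w)\<^sup>2 / L" using L by (simp add: field_simps power2_eq_square)
    finally show ?thesis using L by (simp add: w_def field_simps)
  qed
  have "Inf V < m + c\<^sup>2 / L" using c L by (simp add: m_def)
  then obtain v where "v \<in> V" "v < m + c\<^sup>2 / L"
    using cInf_less_iff[OF \<open>V \<noteq> {}\<close> bdd] by blast
  then obtain y where y: "norm y = 1" "inner (Op P y) y < m + c\<^sup>2 / L"
    by (auto simp: V_def)
  have "inner (Op Q y) y < c\<^sup>2 / L"
    using y by (simp add: Q inner_diff_left flip: power2_norm_eq_inner)
  then have "(norm (Op Q y))\<^sup>2 < c\<^sup>2" using key[of y] L by (simp add: field_simps)
  moreover have "c\<^sup>2 \<le> (norm (Op Q y))\<^sup>2" using c(1) c(2)[of y] y by (intro power_mono) auto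
  ultimately show False by simp
qed

text \<open>Apply positivity to \<open>Q\<^sup>2 - P\<^sup>2\<close>. In this way scalar inequalities become operator inequalities, and
with constant \<open>Q\<close> the operator norm of \<open>P(T)\<close> is controlled by the supremum of \<open>P\<close>.\<close>

lemma norm_operator_poly_mono:
  assumes le: "\<And>t. 0 \<le> t \<Longrightarrow> t \<le> onorm T \<Longrightarrow> \<bar>poly P t\<bar> \<le> poly Q t"
  shows "norm (Op P x) \<le> norm (Op Q x)"
proof -
  have sq: "inner (Op (S * S) x) x = (norm (Op S x))\<^sup>2" for S
    by (simp add: operator_poly_mult[OF bl] operator_poly_symmetric power2_norm_eq_inner)
  have "0 \<le> poly (Q * Q - P * P) t" if "0 \<le> t" "t \<le> onorm T" for t
    using power_mono[OF le[OF that], of 2] by (simp add: power2_eq_square)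
  then have "0 \<le> inner (Op (Q * Q - P * P) x) x" by (rule operator_poly_nonneg)
  then have "(norm (Op P x))\<^sup>2 \<le> (norm (Op Q x))\<^sup>2"
    by (simp add: operator_poly_diff[OF bl] inner_diff_left sq)
  then show ?thesis by (rule power2_le_imp_le) simp
qed

lemma norm_operator_poly_le:
  assumes "\<And>t. 0 \<le> t \<Longrightarrow> t \<le> onorm T \<Longrightarrow> \<bar>poly P t\<bar> \<le> m"
  shows "norm (Op P x) \<le> m * norm x"
proof -
  have "0 \<le> m" using assms[of 0] onorm_pos_le[OF bl] by simp
  then show ?thesis using norm_operator_poly_mono[of P "[:m:]" x] assms
    by (simp add: operator_poly_const)
qed

end

section \<open>Powers of a positive operator\<close>

lemma uniform_limit_poly_exists:
  fixes g :: "real \<Rightarrow> real"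
  assumes "continuous_on {a..b} g"
  shows "\<exists>P. uniform_limit {a..b} (\<lambda>n. poly (P n)) g sequentially"
proof -
  have "\<exists>Q. \<forall>t\<in>{a..b}. \<bar>g t - poly Q t\<bar> < 1 / real (Suc n)" for n
  proof -
    obtain h where h: "real_polynomial_function h" "\<And>t. t \<in> {a..b} \<Longrightarrow> \<bar>g t - h t\<bar> < 1 / real (Suc n)"
      using Stone_Weierstrass_real_polynomial_function[OF compact_Icc assms, of "1 / real (Suc n)"] by auto
    obtain c N where "h = (\<lambda>t. \<Sum>i\<le>N. c i * t ^ i)"
      using h(1) by (auto simp: real_polynomial_function_iff_sum)
    then have "poly (\<Sum>i\<le>N. monom (c i) i) t = h t" for t by (simp add: poly_sum poly_monom)
    then show ?thesis using h(2) by metis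
  qed
  then obtain P where P: "\<And>n t. t \<in> {a..b} \<Longrightarrow> \<bar>g t - poly (P n) t\<bar> < 1 / real (Suc n)" by metis
  have "uniform_limit {a..b} (\<lambda>n. poly (P n)) g sequentially"
  proof (rule uniform_limitI)
    fix e :: real assume "0 < e"
    then obtain N where N: "1 / real (Suc N) < e" using nat_approx_posE by blast
    show "\<forall>\<^sub>F n in sequentially. \<forall>t\<in>{a..b}. dist (poly (P n) t) (g t) < e"
      using eventually_ge_at_top[of N]
    proof eventually_elim
      case (elim n)
      then have "1 / real (Suc n) \<le> 1 / real (Suc N)" by (intro divide_left_mono) auto
      then show ?case using P[of _ n] N by (force simp: dist_real_def abs_minus_commute)
    qed
  qed
  then show ?thesis by blast
qed

lemma uniform_limit_poly_mult:
  fixes g h :: "real \<Rightarrow> real"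
  assumes "uniform_limit {a..b} (\<lambda>n. poly (P n)) g sequentially" "continuous_on {a..b} g"
    and "uniform_limit {a..b} (\<lambda>n. poly (Q n)) h sequentially" "continuous_on {a..b} h"
  shows "uniform_limit {a..b} (\<lambda>n. poly (P n * Q n)) (\<lambda>t. g t * h t) sequentially"
proof -
  have "bounded (g ` {a..b})" "bounded (h ` {a..b})"
    using assms by (auto intro!: compact_imp_bounded compact_continuous_image)
  then have "uniform_limit {a..b} (\<lambda>n t. poly (P n) t * poly (Q n) t) (\<lambda>t. g t * h t) sequentially"
    by (intro uniform_lim_mult assms)
  then show ?thesis by (simp add: poly_mult[abs_def] fun_eq_iff)
qed

lemma continuous_on_powr_Icc: "0 < s \<Longrightarrow> continuous_on {0..b::real} (\<lambda>t. t powr s)"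
  by (intro continuous_on_powr' continuous_intros) auto

context
  fixes T :: "'h::{real_inner,complete_space} \<Rightarrow> 'h"
  assumes T: "positive_operator T"
begin

private lemmas bounded_T = positive_operatorD(1)[OF T]
private abbreviation (input) "PolyT P \<equiv> operator_poly P T"

text \<open>Uniformly close polynomials have close operator values, so the limit depends on the limit function
alone. This gives uniqueness of the functional calculus and lets each later argument choose its own
approximating sequence.\<close>

lemma operator_poly_same_limit:
  assumes P: "uniform_limit {0..onorm T} (\<lambda>n. poly (P n)) g sequentially"
    and Q: "uniform_limit {0..onorm T} (\<lambda>n. poly (Q n)) g sequentially"
    and lim: "(\<lambda>n. PolyT (P n) x) \<longlonglongrightarrow> y"
  shows "(\<lambda>n. PolyT (Q n) x) \<longlonglongrightarrow> y"
proof -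
  have "(\<lambda>n. PolyT (Q n) x - PolyT (P n) x) \<longlonglongrightarrow> 0"
  proof (rule metric_LIMSEQ_I)
    fix e :: real assume e: "0 < e"
    define d where "d = e / (norm x + 1)"
    have d: "0 < d" "d * norm x < e" using e by (auto simp: d_def field_simps add_pos_nonneg)
    have "\<forall>\<^sub>F n in sequentially. dist (PolyT (Q n) x - PolyT (P n) x) 0 < e"
      using uniform_limitD[OF P half_gt_zero[OF d(1)]] uniform_limitD[OF Q half_gt_zero[OF d(1)]]
    proof eventually_elim
      case (elim n)
      have "\<bar>poly (Q n - P n) t\<bar> \<le> d" if "0 \<le> t" "t \<le> onorm T" for t
      proof -
        have "\<bar>poly (P n) t - g t\<bar> < d / 2" "\<bar>poly (Q n) t - g t\<bar> < d / 2"
          using elim[THEN bspec, of t] that by (simp_all add: dist_real_def)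
        then show ?thesis unfolding poly_diff by linarith
      qed
      then have "norm (PolyT (Q n - P n) x) \<le> d * norm x" by (rule norm_operator_poly_le[OF T])
      then show ?case using d by (simp add: operator_poly_diff[OF bounded_T])
    qed
    then show "\<exists>N. \<forall>n\<ge>N. dist (PolyT (Q n) x - PolyT (P n) x) 0 < e"
      by (simp add: eventually_sequentially)
  qed
  from tendsto_add[OF this lim] show ?thesis by simp
qed

lemma is_operator_function_tendsto:
  assumes S: "is_operator_function g T S"
    and Q: "uniform_limit {0..onorm T} (\<lambda>n. poly (Q n)) g sequentially"
  shows "(\<lambda>n. PolyT (Q n) x) \<longlonglongrightarrow> S x"
proof -
  obtain P where P: "uniform_limit {0..onorm T} (\<lambda>n. poly (P n)) g sequentially"
    and lim: "(\<lambda>n. onorm (\<lambda>x. PolyT (P n) x - S x)) \<longlonglongrightarrow> 0" and blS: "bounded_linear S"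
    using S unfolding is_operator_function_def by blast
  have "(\<lambda>n. PolyT (P n) x - S x) \<longlonglongrightarrow> 0"
  proof (rule Lim_null_comparison)
    show "\<forall>\<^sub>F n in sequentially. norm (PolyT (P n) x - S x) \<le> onorm (\<lambda>x. PolyT (P n) x - S x) * norm x"
      by (intro always_eventually allI onorm bounded_linear_sub bounded_linear_operator_poly bounded_T blS)
    show "(\<lambda>n. onorm (\<lambda>x. PolyT (P n) x - S x) * norm x) \<longlonglongrightarrow> 0"
      using tendsto_mult_right[OF lim, of "norm x"] by simp
  qed
  then have "(\<lambda>n. PolyT (P n) x) \<longlonglongrightarrow> S x" by (simp add: LIM_zero_iff)
  then show ?thesis by (rule operator_poly_same_limit[OF P Q])
qed

lemma is_operator_function_unique:
  assumes "is_operator_function g T S" "is_operator_function g T S'"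
  shows "S = S'"
proof
  fix x
  obtain P where "uniform_limit {0..onorm T} (\<lambda>n. poly (P n)) g sequentially"
    using assms(1) unfolding is_operator_function_def by blast
  then show "S x = S' x"
    using is_operator_function_tendsto[OF assms(1)] is_operator_function_tendsto[OF assms(2)]
      LIMSEQ_unique by blast
qed

text \<open>The values \<open>P\<^sub>n(T)\<close> form a Cauchy sequence in operator norm, so their pointwise limit is bounded and
is also their limit in norm.\<close>

lemma is_operator_function_exists:
  assumes "continuous_on {0..onorm T} g"
  shows "\<exists>S. is_operator_function g T S"
proof -
  obtain P where P: "uniform_limit {0..onorm T} (\<lambda>n. poly (P n)) g sequentially"
    using uniform_limit_poly_exists[OF assms] by blast
  have near: "\<exists>N. \<forall>m\<ge>N. \<forall>n\<ge>N. \<forall>x. norm (PolyT (P m) x - PolyT (P n) x) \<le> e * norm x" if e: "0 < e" for e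
  proof -
    obtain N where N: "\<forall>n\<ge>N. \<forall>t\<in>{0..onorm T}. dist (poly (P n) t) (g t) < e / 2"
      using uniform_limitD[OF P half_gt_zero[OF e]] unfolding eventually_sequentially by blast
    have "norm (PolyT (P m) x - PolyT (P n) x) \<le> e * norm x" if "N \<le> m" "N \<le> n" for m n x
    proof -
      have "\<bar>poly (P m - P n) t\<bar> \<le> e" if "0 \<le> t" "t \<le> onorm T" for t
      proof -
        have "\<bar>poly (P k) t - g t\<bar> < e / 2" if "N \<le> k" for k
          using N[rule_format, OF that, of t] \<open>0 \<le> t\<close> \<open>t \<le> onorm T\<close> by (simp add: dist_real_def)
        from this[OF \<open>N \<le> m\<close>] this[OF \<open>N \<le> n\<close>] show ?thesis unfolding poly_diff by linarith
      qed
      then have "norm (PolyT (P m - P n) x) \<le> e * norm x" by (rule norm_operator_poly_le[OF T])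
      then show ?thesis by (simp add: operator_poly_diff[OF bounded_T])
    qed
    then show ?thesis by blast
  qed
  have "Cauchy (\<lambda>n. PolyT (P n) x)" for x
  proof (rule metric_CauchyI)
    fix e :: real assume e: "0 < e"
    define d where "d = e / (norm x + 1)"
    have d: "0 < d" "d * norm x < e" using e by (auto simp: d_def field_simps add_pos_nonneg)
    then show "\<exists>N. \<forall>m\<ge>N. \<forall>n\<ge>N. dist (PolyT (P m) x) (PolyT (P n) x) < e"
      using near[OF d(1)] unfolding dist_norm by (meson le_less_trans)
  qed
  then have "\<exists>y. (\<lambda>n. PolyT (P n) x) \<longlonglongrightarrow> y" for x
    using Cauchy_convergent convergent_def by blast
  then obtain S where S: "\<And>x. (\<lambda>n. PolyT (P n) x) \<longlonglongrightarrow> S x" by metis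
  have near_S: "\<exists>N. \<forall>n\<ge>N. \<forall>x. norm (PolyT (P n) x - S x) \<le> e * norm x" if e: "0 < e" for e
  proof -
    obtain N where N: "\<forall>m\<ge>N. \<forall>n\<ge>N. \<forall>x. norm (PolyT (P m) x - PolyT (P n) x) \<le> e * norm x"
      using near[OF e] by blast
    have "norm (PolyT (P n) x - S x) \<le> e * norm x" if "N \<le> n" for n x
    proof (rule LIMSEQ_le_const2)
      show "(\<lambda>m. norm (PolyT (P n) x - PolyT (P m) x)) \<longlonglongrightarrow> norm (PolyT (P n) x - S x)"
        by (intro tendsto_intros S)
      show "\<exists>N. \<forall>m\<ge>N. norm (PolyT (P n) x - PolyT (P m) x) \<le> e * norm x" using N that by blast
    qed
    then show ?thesis by blast
  qed
  have linS: "linear S"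
  proof (rule linearI)
    fix x y and c :: real
    have "(\<lambda>n. PolyT (P n) (x + y)) \<longlonglongrightarrow> S x + S y"
      unfolding linear_add[OF linear_operator_poly[OF bounded_T]] by (intro tendsto_add S)
    then show "S (x + y) = S x + S y" using S LIMSEQ_unique by blast
    have "(\<lambda>n. PolyT (P n) (c *\<^sub>R x)) \<longlonglongrightarrow> c *\<^sub>R S x"
      unfolding linear_cmul[OF linear_operator_poly[OF bounded_T]] by (intro tendsto_intros S)
    then show "S (c *\<^sub>R x) = c *\<^sub>R S x" using S LIMSEQ_unique by blast
  qed
  have "bounded_linear S"
  proof -
    obtain N where N: "\<forall>n\<ge>N. \<forall>x. norm (PolyT (P n) x - S x) \<le> 1 * norm x" using near_S[of 1] by auto
    have "norm (S x) \<le> norm x * (onorm (PolyT (P N)) + 1)" for x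
    proof -
      have "norm (S x) \<le> norm (PolyT (P N) x) + norm (PolyT (P N) x - S x)"
        using norm_triangle_ineq4[of "PolyT (P N) x" "PolyT (P N) x - S x"] by simp
      also have "\<dots> \<le> onorm (PolyT (P N)) * norm x + norm x"
        using N by (intro add_mono onorm bounded_linear_operator_poly bounded_T) simp
      finally show ?thesis by (simp add: algebra_simps)
    qed
    then show ?thesis
      by (intro bounded_linear_intro[where K = "onorm (PolyT (P N)) + 1"])
        (simp_all add: linear_add[OF linS] linear_cmul[OF linS])
  qed
  moreover have "(\<lambda>n. onorm (\<lambda>x. PolyT (P n) x - S x)) \<longlonglongrightarrow> 0"
  proof (rule metric_LIMSEQ_I)
    fix e :: real assume e: "0 < e"
    obtain N where N: "\<forall>n\<ge>N. \<forall>x. norm (PolyT (P n) x - S x) \<le> e / 2 * norm x"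
      using near_S[OF half_gt_zero[OF e]] by blast
    have "dist (onorm (\<lambda>x. PolyT (P n) x - S x)) 0 < e" if "N \<le> n" for n
    proof -
      have "onorm (\<lambda>x. PolyT (P n) x - S x) \<le> e / 2" using N that e by (intro onorm_bound) auto
      moreover have "0 \<le> onorm (\<lambda>x. PolyT (P n) x - S x)"
        by (intro onorm_pos_le bounded_linear_sub bounded_linear_operator_poly bounded_T \<open>bounded_linear S\<close>)
      ultimately show ?thesis using e by (simp add: dist_real_def)
    qed
    then show "\<exists>N. \<forall>n\<ge>N. dist (onorm (\<lambda>x. PolyT (P n) x - S x)) 0 < e" by blast
  qed
  ultimately show ?thesis unfolding is_operator_function_def using P by blast
qed

lemma is_operator_function_operator_powr:
  assumes "0 < s"
  shows "is_operator_function (\<lambda>t. t powr s) T (operator_powr T s)"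
proof -
  have "\<exists>!S. is_operator_function (\<lambda>t. t powr s) T S"
    using is_operator_function_exists[OF continuous_on_powr_Icc[OF assms]] is_operator_function_unique
    by blast
  then show ?thesis unfolding operator_powr_def by (rule theI')
qed

lemma bounded_linear_operator_powr: "0 < s \<Longrightarrow> bounded_linear (operator_powr T s)"
  using is_operator_function_operator_powr unfolding is_operator_function_def by blast

lemmas operator_powr_tendsto = is_operator_function_tendsto[OF is_operator_function_operator_powr]

lemma uniform_limit_powr_exists:
  "0 < s \<Longrightarrow> \<exists>P. uniform_limit {0..onorm T} (\<lambda>n. poly (P n)) (\<lambda>t. t powr s) sequentially"
  by (intro uniform_limit_poly_exists continuous_on_powr_Icc)

lemma operator_powr_commutes:
  assumes s: "0 < s" and S: "bounded_linear S" and comm: "\<And>x. S (T x) = T (S x)"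
  shows "S (operator_powr T s x) = operator_powr T s (S x)"
proof -
  obtain P where P: "uniform_limit {0..onorm T} (\<lambda>n. poly (P n)) (\<lambda>t. t powr s) sequentially"
    using uniform_limit_powr_exists[OF s] by blast
  have "(\<lambda>n. S (PolyT (P n) x)) \<longlonglongrightarrow> S (operator_powr T s x)"
    by (intro bounded_linear.tendsto[OF S] operator_powr_tendsto s P)
  moreover have "(\<lambda>n. S (PolyT (P n) x)) \<longlonglongrightarrow> operator_powr T s (S x)"
    unfolding operator_poly_commutes[OF bounded_T bounded_linear.linear[OF S] comm]
    by (intro operator_powr_tendsto s P)
  ultimately show ?thesis by (rule LIMSEQ_unique)
qed

text \<open>The square root is approximated by the squares \<open>R\<^sub>n\<^sup>2\<close> with \<open>R\<^sub>n \<rightarrow> t\<^bsup>1/4\<^esup>\<close>: then the approximating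
operators are positive, and so is their limit. Squaring once more gives polynomials tending to \<open>t\<close>.\<close>

lemma operator_powr_half:
  shows "positive_operator (operator_powr T (1/2))"
    and "operator_powr T (1/2) (operator_powr T (1/2) x) = T x"
proof -
  let ?B = "operator_powr T (1/2)"
  obtain R where R: "uniform_limit {0..onorm T} (\<lambda>n. poly (R n)) (\<lambda>t. t powr (1/4)) sequentially"
    using uniform_limit_powr_exists[of "1/4"] by auto
  define Q where "Q n = R n * R n" for n
  have Q: "uniform_limit {0..onorm T} (\<lambda>n. poly (Q n)) (\<lambda>t. t powr (1/2)) sequentially"
    using uniform_limit_poly_mult[OF R _ R] continuous_on_powr_Icc[of "1/4" "onorm T"]
    by (simp add: Q_def powr_add[symmetric])
  have B: "(\<lambda>n. PolyT (Q n) x) \<longlonglongrightarrow> ?B x" for x by (intro operator_powr_tendsto Q) simp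
  have sym: "inner (?B x) y = inner x (?B y)" for x y
  proof -
    have "(\<lambda>n. inner (PolyT (Q n) x) y) \<longlonglongrightarrow> inner (?B x) y" by (intro tendsto_intros B)
    moreover have "(\<lambda>n. inner (PolyT (Q n) x) y) \<longlonglongrightarrow> inner x (?B y)"
      unfolding operator_poly_symmetric[OF T] by (intro tendsto_intros B)
    ultimately show ?thesis by (rule LIMSEQ_unique)
  qed
  have "0 \<le> inner (?B x) x" for x
  proof (rule LIMSEQ_le_const)
    show "(\<lambda>n. inner (PolyT (Q n) x) x) \<longlonglongrightarrow> inner (?B x) x" by (intro tendsto_intros B)
    have "0 \<le> inner (PolyT (Q n) x) x" for n
      unfolding Q_def operator_poly_mult[OF bounded_T] operator_poly_symmetric[OF T, of _ "PolyT (R n) x"] by simp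
    then show "\<exists>N. \<forall>n\<ge>N. 0 \<le> inner (PolyT (Q n) x) x" by blast
  qed
  then show "positive_operator ?B"
    unfolding positive_operator_def using sym bounded_linear_operator_powr[of "1/2"] by simp
  have "uniform_limit {0..onorm T} (\<lambda>n. poly (Q n * Q n)) (\<lambda>t. t powr (1/2) * t powr (1/2)) sequentially"
    by (intro uniform_limit_poly_mult Q continuous_on_powr_Icc) simp_all
  then have QQ: "uniform_limit {0..onorm T} (\<lambda>n. poly (Q n * Q n)) (\<lambda>t. t) sequentially"
    by (rule uniform_limit_cong'[THEN iffD1, rotated 2]) (auto simp: powr_add[symmetric])
  have "uniform_limit {0..onorm T} (\<lambda>n. poly [:0, 1:]) (\<lambda>t. t) sequentially"
    by (rule uniform_limitI) simp
  moreover have "(\<lambda>n. PolyT [:0, 1:] x) \<longlonglongrightarrow> T x"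
    by (simp add: operator_poly_pCons[OF bounded_T] operator_poly_0 linear_0[OF bounded_linear.linear[OF bounded_T]])
  ultimately have lim: "(\<lambda>n. PolyT (Q n * Q n) x) \<longlonglongrightarrow> T x"
    by (rule operator_poly_same_limit[OF _ QQ])
  show "?B (?B x) = T x"
  proof (rule inner_left_eqI)
    fix y
    have "(\<lambda>n. inner (PolyT (Q n) y) (PolyT (Q n) x)) \<longlonglongrightarrow> inner (?B y) (?B x)"
      by (intro tendsto_intros B)
    moreover have "(\<lambda>n. inner (PolyT (Q n) y) (PolyT (Q n) x)) \<longlonglongrightarrow> inner y (T x)"
      unfolding operator_poly_symmetric[OF T] operator_poly_mult[OF bounded_T, symmetric]
      by (intro tendsto_intros lim)
    ultimately have "inner (?B y) (?B x) = inner y (T x)" by (rule LIMSEQ_unique)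
    then show "inner y (?B (?B x)) = inner y (T x)" by (simp add: sym)
  qed
qed

text \<open>The scalar inequality \<open>t\<^bsup>s\<^esup> \<le> a\<^bsup>s/2-1\<^esup> (a + t\<^sup>2)\<close>, transferred to \<open>T\<close> through polynomials approximating
\<open>t\<^bsup>s\<^esup>\<close>. The right-hand side is already a polynomial, so the inverse \<open>(a + T\<^sup>2)\<^sup>-\<^sup>1\<close> never has to
be approximated. It is here that \<open>s \<le> 2\<close> enters.\<close>

lemma norm_operator_powr_le:
  assumes s: "0 < s" "s \<le> 2" and a: "0 < a"
  shows "norm (operator_powr T s x) \<le> a powr (s / 2 - 1) * norm (a *\<^sub>R x + T (T x))"
proof (rule field_le_epsilon)
  fix e :: real assume e: "0 < e"
  define k where "k = a powr (s / 2 - 1)"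
  define d where "d = e / (norm x + 1)"
  have d: "0 < d" "d * norm x \<le> e" using e by (auto simp: d_def field_simps add_pos_nonneg)
  have young: "t powr s \<le> k * (a + t\<^sup>2)" if t: "0 \<le> t" for t
  proof -
    have "t powr s = (t\<^sup>2) powr (s / 2)"
      using t by (cases "t = 0") (simp_all add: powr_powr flip: powr_numeral)
    also have "\<dots> \<le> (a + t\<^sup>2) powr (s / 2)" using s a by (intro powr_mono2) auto
    also have "\<dots> = (a + t\<^sup>2) powr (s / 2 - 1) * (a + t\<^sup>2)"
      using a powr_add[of "a + t\<^sup>2" "s / 2 - 1" 1] by (simp add: add_pos_nonneg)
    also have "\<dots> \<le> a powr (s / 2 - 1) * (a + t\<^sup>2)"
      using s a by (intro mult_right_mono powr_mono2') auto
    finally show ?thesis by (simp add: k_def)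
  qed
  obtain P where P: "uniform_limit {0..onorm T} (\<lambda>n. poly (P n)) (\<lambda>t. t powr s) sequentially"
    using uniform_limit_powr_exists[OF s(1)] by blast
  have "\<forall>\<^sub>F n in sequentially. norm (PolyT (P n) x) \<le> k * norm (a *\<^sub>R x + T (T x)) + e"
    using uniform_limitD[OF P d(1)]
  proof eventually_elim
    case (elim n)
    have "\<bar>poly (P n) t\<bar> \<le> poly [:k * a + d, 0, k:] t" if "0 \<le> t" "t \<le> onorm T" for t
    proof -
      have "\<bar>poly (P n) t - t powr s\<bar> < d"
        using elim[THEN bspec, of t] that by (simp add: dist_real_def)
      moreover have "0 \<le> t powr s" by simp
      ultimately have "\<bar>poly (P n) t\<bar> \<le> k * (a + t\<^sup>2) + d" using young[OF that(1)] by linarith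
      then show ?thesis by (simp add: power2_eq_square algebra_simps)
    qed
    then have "norm (PolyT (P n) x) \<le> norm (PolyT [:k * a + d, 0, k:] x)"
      by (rule norm_operator_poly_mono[OF T])
    also have "PolyT [:k * a + d, 0, k:] x = k *\<^sub>R (a *\<^sub>R x + T (T x)) + d *\<^sub>R x"
      using linear_0[OF bounded_linear.linear[OF bounded_T]] linear_cmul[OF bounded_linear.linear[OF bounded_T]]
      by (simp add: operator_poly_pCons[OF bounded_T] operator_poly_0 algebra_simps)
    also have "norm \<dots> \<le> k * norm (a *\<^sub>R x + T (T x)) + d * norm x"
      using norm_triangle_ineq[of "k *\<^sub>R (a *\<^sub>R x + T (T x))" "d *\<^sub>R x"] d by (simp add: k_def)
    finally show ?case using d by simp
  qed
  moreover have "(\<lambda>n. norm (PolyT (P n) x)) \<longlonglongrightarrow> norm (operator_powr T s x)"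
    by (intro tendsto_norm operator_powr_tendsto s P)
  ultimately show "norm (operator_powr T s x) \<le> a powr (s / 2 - 1) * norm (a *\<^sub>R x + T (T x)) + e"
    unfolding k_def by (intro tendsto_upperbound) auto
qed

end

text \<open>With \<open>B = |A|\<close>, so \<open>B\<^sup>2 = A\<^sup>* A\<close>, the resolvent commutes with \<open>B\<^sup>p\<close>, and the preceding bound is applied at
\<open>x = R\<^sub>a v\<close>, where \<open>a x + B\<^sup>2 x = v\<close>.\<close>

lemma source_condition_error:
  fixes A :: "'h::{real_inner,complete_space} \<Rightarrow> 'f::{real_inner,complete_space}"
  assumes A: "bounded_linear A" and p: "0 < p" "p \<le> 2" and a: "0 < a"
  shows "a * norm (resolvent A a (operator_powr (operator_abs A) p v)) \<le> a powr (p / 2) * norm v"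
proof -
  let ?T = "\<lambda>x. adjoint A (A x)" and ?R = "resolvent A a" and ?B = "operator_abs A"
  have T: "positive_operator ?T" by (rule positive_operator_normal[OF A])
  have B_eq: "?B = operator_powr ?T (1/2)" by (simp add: operator_abs_def o_def)
  have B: "positive_operator ?B" and BB: "\<And>x. ?B (?B x) = ?T x"
    unfolding B_eq by (rule operator_powr_half[OF T])+
  have R: "bounded_linear ?R"
    using norm_scaled_resolvent_le[OF A a] linear_resolvent[OF A a] a
    by (intro bounded_linear_intro[where K = "1 / a"]) (auto simp: linear_add linear_cmul field_simps)
  have "?R (?T x) = ?T (?R x)" for x using resolvent_normal_commute[OF A a] by simp
  then have "?R (?B x) = ?B (?R x)" for x
    unfolding B_eq by (intro operator_powr_commutes[OF T _ R]) auto
  then have "?R (operator_powr ?B p v) = operator_powr ?B p (?R v)"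
    by (intro operator_powr_commutes[OF B p(1) R])
  then have "norm (?R (operator_powr ?B p v)) \<le> a powr (p / 2 - 1) * norm (a *\<^sub>R ?R v + ?T (?R v))"
    using norm_operator_powr_le[OF B p a, of "?R v"] by (simp add: BB)
  also have "\<dots> = a powr (p / 2 - 1) * norm v" by (simp add: resolvent_solves[OF A a])
  finally have "a * norm (?R (operator_powr ?B p v)) \<le> a * (a powr (p / 2 - 1) * norm v)"
    using a by simp
  also have "\<dots> = a powr (p / 2) * norm v" using a powr_add[of a 1 "p / 2 - 1"] by simp
  finally show ?thesis .
qed

section \<open>Local extrema of a finite sequence\<close>

text \<open>
The sequence reaches \<open>k\<close> from above: before \<open>k\<close> it has a value different from \<open>g k\<close>, and the last such
value is larger. Stating this with the absolute index \<open>i\<close> avoids truncated differences.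
\<close>

definition descends_to :: "(nat \<Rightarrow> real) \<Rightarrow> nat \<Rightarrow> bool" where
  "descends_to g k \<longleftrightarrow> (\<exists>i<k. g k < g i \<and> (\<forall>l. i < l \<and> l < k \<longrightarrow> g l = g k))"

lemma descends_to_iff:
  "(\<exists>j\<ge>1. j \<le> k \<and> (\<forall>i<j. g (k - i) = g k) \<and> g k < g (k - j)) \<longleftrightarrow> descends_to g k"
proof
  assume "\<exists>j\<ge>1. j \<le> k \<and> (\<forall>i<j. g (k - i) = g k) \<and> g k < g (k - j)"
  then obtain j where j: "1 \<le> j" "j \<le> k" and eq: "\<forall>i<j. g (k - i) = g k" and less: "g k < g (k - j)"
    by blast
  have "g l = g k" if "k - j < l" "l < k" for l
  proof -
    have "k - l < j" "k - (k - l) = l" using that j by arith+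
    then show ?thesis using eq by metis
  qed
  moreover have "k - j < k" using j by arith
  ultimately show "descends_to g k" unfolding descends_to_def using less by blast
next
  assume "descends_to g k"
  then obtain i where i: "i < k" and less: "g k < g i" and eq: "\<forall>l. i < l \<and> l < k \<longrightarrow> g l = g k"
    unfolding descends_to_def by blast
  have "g (k - l) = g k" if "l < k - i" for l
  proof (cases "l = 0")
    case False
    then have "i < k - l" "k - l < k" using that i by arith+
    then show ?thesis using eq by blast
  qed simp
  moreover have "1 \<le> k - i" "k - i \<le> k" "k - (k - i) = i" using i by arith+
  ultimately show "\<exists>j\<ge>1. j \<le> k \<and> (\<forall>i<j. g (k - i) = g k) \<and> g k < g (k - j)"
    using less by (intro exI[of _ "k - i"]) simp
qed

lemma local_min_index_iff:
  "local_min_index g M k \<longleftrightarrow>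
     (k < M \<and> g k < g (k + 1) \<and> (0 < k \<longrightarrow> descends_to g k)) \<or> (k = M \<and> descends_to g M)"
  unfolding local_min_index_def descends_to_iff by simp

lemma local_max_index_iff:
  "local_max_index g M k \<longleftrightarrow> 0 < k \<and> k < M \<and> g (k + 1) < g k \<and> descends_to (\<lambda>i. - g i) k"
  unfolding local_max_index_def descends_to_iff[symmetric] by simp

text \<open>Only interior indices are symmetric under change of sign, since a boundary index can be a minimum but
never a maximum. Statements about maxima are obtained from those about minima by negation, with the
length enlarged by one so that the right end counts as interior.\<close>

lemma local_min_index_uminus:
  assumes "0 < k" "k < M"
  shows "local_min_index (\<lambda>i. - g i) M k \<longleftrightarrow> local_max_index g M k"
  using assms by (simp add: local_max_index_iff local_min_index_iff)

lemma descends_to_below: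
  assumes "i < k" "g k < g i" "\<And>l. i \<le> l \<Longrightarrow> l < k \<Longrightarrow> g k \<le> g l"
  shows "descends_to g k"
proof -
  define j where "j = (GREATEST l. l < k \<and> g k < g l)"
  have ex: "i < k \<and> g k < g i" using assms by simp
  have j: "j < k \<and> g k < g j" unfolding j_def by (rule GreatestI_nat[of _ i k]) (use ex in auto)
  have le: "l \<le> j" if "l < k" "g k < g l" for l
    unfolding j_def by (rule Greatest_le_nat[of _ _ k]) (use that in auto)
  have "g l = g k" if "j < l" "l < k" for l
    using assms(3)[of l] le[of l] le[OF assms(1,2)] that by force
  then show ?thesis unfolding descends_to_def using j by blast
qed

lemma descends_to_above:
  assumes "descends_to g k" "i < k" "g i \<noteq> g k"
  shows "\<exists>l\<ge>i. l < k \<and> g k < g l"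
proof -
  obtain j where j: "j < k" "g k < g j" "\<And>l. j < l \<Longrightarrow> l < k \<Longrightarrow> g l = g k"
    using assms(1) by (auto simp: descends_to_def)
  then have "i \<le> j" using assms by (meson not_le)
  then show ?thesis using j by blast
qed

text \<open>Taking the last minimum position makes the sequence rise strictly right after it, which is what a
local minimum before the end of the sequence requires.\<close>

lemma last_minimum:
  fixes g :: "nat \<Rightarrow> real"
  assumes "a \<le> b"
  obtains l where "a \<le> l" "l \<le> b" "\<And>i. a \<le> i \<Longrightarrow> i \<le> b \<Longrightarrow> g l \<le> g i"
    "\<And>i. l < i \<Longrightarrow> i \<le> b \<Longrightarrow> g l < g i"
proof -
  define m where "m = Min (g ` {a..b})"
  have mle: "m \<le> g i" if "a \<le> i" "i \<le> b" for i unfolding m_def using that by (intro Min_le) auto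
  have "m \<in> g ` {a..b}" unfolding m_def using assms by (intro Min_in) auto
  then obtain i where i: "a \<le> i" "i \<le> b" "g i = m" by auto
  define l where "l = (GREATEST l. a \<le> l \<and> l \<le> b \<and> g l = m)"
  have l: "a \<le> l \<and> l \<le> b \<and> g l = m" unfolding l_def
    by (rule GreatestI_nat[of _ i b]) (use i in auto)
  have "m < g j" if "l < j" "j \<le> b" for j
  proof -
    have "g j \<noteq> m"
    proof
      assume "g j = m"
      then have "j \<le> l" unfolding l_def by (intro Greatest_le_nat[of _ _ b]) (use that l in auto)
      then show False using that by simp
    qed
    then show ?thesis using mle[of j] that l by force
  qed
  then show ?thesis using that[of l] l mle by auto
qed

text \<open>The last minimum position on \<open>[a, b]\<close>: the drop after \<open>a\<close> keeps it away from \<open>a\<close>, and \<open>fin\<close> keeps it away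
from \<open>b\<close> unless \<open>b\<close> is the end of the sequence, where a minimum needs no rise afterwards.\<close>

lemma local_min_index_after_drop:
  assumes "a < b" "b \<le> M" "g (a + 1) < g a" and fin: "b = M \<or> (\<exists>i. a \<le> i \<and> i < b \<and> g i < g b)"
  shows "\<exists>l. a < l \<and> l \<le> b \<and> (b \<noteq> M \<longrightarrow> l < b) \<and> local_min_index g M l"
proof -
  obtain l where l: "a \<le> l" "l \<le> b" "\<And>i. a \<le> i \<Longrightarrow> i \<le> b \<Longrightarrow> g l \<le> g i"
    "\<And>i. l < i \<Longrightarrow> i \<le> b \<Longrightarrow> g l < g i"
    using last_minimum[of a b g] assms by (metis less_imp_le)
  have gl: "g l < g a" using l(3)[of "a + 1"] assms by simp
  then have al: "a < l" using l(1) by (cases "a = l") auto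
  have desc: "descends_to g l"
    using l al gl by (intro descends_to_below[of a]) auto
  show ?thesis
  proof (cases "l = M")
    case True
    then show ?thesis using desc al l by (auto simp: local_min_index_iff intro!: exI[of _ l])
  next
    case False
    have "l < b"
    proof (rule ccontr)
      assume "\<not> l < b"
      then have lb: "l = b" using l by simp
      then obtain i where "a \<le> i" "i < b" "g i < g b" using fin False by blast
      then show False using l(3)[of i] lb by simp
    qed
    then have "g l < g (l + 1)" "l < M" using l(4)[of "l + 1"] assms by auto
    then show ?thesis using desc al l \<open>l < b\<close> by (auto simp: local_min_index_iff intro!: exI[of _ l])
  qed
qed

lemma local_min_between_local_max:
  assumes a: "local_max_index g M a" and b: "local_max_index g M b \<or> b = M" and "a < b"
  shows "\<exists>l. a < l \<and> l \<le> b \<and> local_min_index g M l \<and> (local_max_index g M b \<longrightarrow> l < b)"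
proof -
  have drop: "g (a + 1) < g a" using a by (simp add: local_max_index_iff)
  have "b = M \<or> (\<exists>i. a \<le> i \<and> i < b \<and> g i < g b)"
  proof (cases "b = M")
    case False
    then have d: "descends_to (\<lambda>i. - g i) b" using b by (simp add: local_max_index_iff)
    have "\<exists>i\<in>{a, a + 1}. i < b \<and> g i \<noteq> g b"
    proof (cases "a + 1 < b")
      case True
      then show ?thesis using drop by auto
    next
      case False
      then have "b = a + 1" using \<open>a < b\<close> by simp
      then show ?thesis using drop by auto
    qed
    then show ?thesis using descends_to_above[OF d] by fastforce
  qed simp
  moreover have "b \<le> M" using b by (auto simp: local_max_index_iff)
  moreover have "local_max_index g M b \<Longrightarrow> b \<noteq> M" by (simp add: local_max_index_iff)
  ultimately show ?thesis using local_min_index_after_drop[OF \<open>a < b\<close> _ drop] by blast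
qed

lemma local_max_between_local_min:
  assumes a: "local_min_index g M a" and b: "local_min_index g M b" and "a < b"
  shows "\<exists>l. a < l \<and> l < b \<and> local_max_index g M l"
proof -
  have bM: "b \<le> M" using b by (auto simp: local_min_index_iff)
  have rise: "g a < g (a + 1)" using a bM \<open>a < b\<close> by (auto simp: local_min_index_iff)
  have d: "descends_to g b" using b \<open>a < b\<close> by (auto simp: local_min_index_iff)
  have "\<exists>i\<in>{a, a + 1}. i < b \<and> g i \<noteq> g b"
  proof (cases "a + 1 < b")
    case True
    then show ?thesis using rise by auto
  next
    case False
    then have "b = a + 1" using \<open>a < b\<close> by simp
    then show ?thesis using rise by auto
  qed
  then obtain k where "a \<le> k" "k < b" "g k \<noteq> g b" by (auto dest: Suc_leD intro: that[of a] that[of "Suc a"])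
  then obtain i where i: "a \<le> i" "i < b" "g b < g i"
    using descends_to_above[OF d] by (meson order_trans)
  have "\<exists>l. a < l \<and> l \<le> b \<and> (b \<noteq> M + 1 \<longrightarrow> l < b) \<and> local_min_index (\<lambda>i. - g i) (M + 1) l"
    by (rule local_min_index_after_drop) (use rise i bM \<open>a < b\<close> in auto)
  then obtain l where l: "a < l" "l < b" "local_min_index (\<lambda>i. - g i) (M + 1) l" using bM by auto
  then have "local_max_index g (M + 1) l" using bM by (subst (asm) local_min_index_uminus) auto
  then have "local_max_index g M l" using l bM by (simp add: local_max_index_iff)
  then show ?thesis using l by blast
qed

text \<open>If the sequence rose somewhere on the way from \<open>n\<close> to \<open>m\<close>, the last minimum position before the rise
would be a local minimum in between. At \<open>n = 0\<close> this position may lie on an initial plateau, which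
does not count as a local minimum; this case is excluded by the assumption \<open>start\<close>.\<close>

lemma antimono_before_local_min:
  assumes start: "local_max_index g M n \<or> (n = 0 \<and> \<not> rises_from_initial_plateau g M)"
    and none: "\<And>l. n \<le> l \<Longrightarrow> l < m \<Longrightarrow> \<not> local_min_index g M l"
    and "m \<le> M" "n \<le> j" "j \<le> i" "i \<le> m"
  shows "g i \<le> g j"
proof (rule ccontr)
  assume "\<not> ?thesis"
  then have ji: "g j < g i" by simp
  obtain l where l: "n \<le> l" "l \<le> i" "\<And>k. n \<le> k \<Longrightarrow> k \<le> i \<Longrightarrow> g l \<le> g k"
    "\<And>k. l < k \<Longrightarrow> k \<le> i \<Longrightarrow> g l < g k"
    using last_minimum[of n i g] assms by (metis order_trans)
  have "g l < g i" using l(3)[of j] ji assms by simp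
  then have li: "l < i" using l(2) by (cases "l = i") auto
  then have rise: "g l < g (l + 1)" "l < M" using l(4)[of "l + 1"] assms by auto
  have "descends_to g l" if "0 < l"
    using start
  proof
    assume n: "local_max_index g M n"
    then have "g (n + 1) < g n" by (simp add: local_max_index_iff)
    then have "n \<noteq> l" using rise by auto
    then have nl: "n < l" using l by simp
    then have "g l < g n" using l(3)[of "n + 1"] li \<open>g (n + 1) < g n\<close> by simp
    then show ?thesis using nl l by (intro descends_to_below[of n]) auto
  next
    assume n: "n = 0 \<and> \<not> rises_from_initial_plateau g M"
    then have "\<not> (\<forall>k\<le>l. g k = g 0)" using that rise unfolding rises_from_initial_plateau_def by blast
    then obtain k where "k \<le> l" "g k \<noteq> g l" by (metis le0)
    moreover have "g l \<le> g k" using l(3)[of k] n li \<open>k \<le> l\<close> by simp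
    ultimately have "k < l" "g l < g k" by (auto simp: le_less)
    then show ?thesis using l n by (intro descends_to_below[of k]) auto
  qed
  then have "local_min_index g M l" using rise by (simp add: local_min_index_iff)
  then show False using none[of l] l li assms by simp
qed

text \<open>A fall would produce a local maximum between \<open>m\<close> and \<open>n\<close>.\<close>

lemma mono_after_local_min:
  assumes m: "local_min_index g M m"
    and none: "\<And>l. m < l \<Longrightarrow> l < n \<Longrightarrow> \<not> local_max_index g M l"
    and "n \<le> M" "m \<le> i" "i \<le> j" "j \<le> n"
  shows "g i \<le> g j"
proof (rule ccontr)
  assume "\<not> ?thesis"
  then have ji: "g j < g i" by simp
  then have "i < j" using assms by (cases "i = j") auto
  then have mM: "m < M" using assms by simp
  have rise: "g m < g (m + 1)" using m mM by (simp add: local_min_index_iff)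
  have "\<exists>l. m < l \<and> l \<le> j \<and> (j \<noteq> M + 1 \<longrightarrow> l < j) \<and> local_min_index (\<lambda>i. - g i) (M + 1) l"
    by (rule local_min_index_after_drop) (use rise ji assms \<open>i < j\<close> in auto)
  then obtain l where l: "m < l" "l < j" "local_min_index (\<lambda>i. - g i) (M + 1) l"
    using assms by auto
  then have "local_max_index g (M + 1) l" using assms by (subst (asm) local_min_index_uminus) auto
  then have "local_max_index g M l" using l assms by (simp add: local_max_index_iff)
  then show False using none[of l] l assms by simp
qed

section \<open>Valleys of a finite sequence\<close>

definition min_indices :: "(nat \<Rightarrow> real) \<Rightarrow> nat \<Rightarrow> nat list" where
  "min_indices g M = sorted_list_of_set {k. local_min_index g M k}"

lemma finite_local_min: "finite {k. local_min_index g M k}"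
  by (rule finite_subset[of _ "{..M}"]) (auto simp: local_min_index_def)

lemma set_min_indices: "l \<in> set (min_indices g M) \<longleftrightarrow> local_min_index g M l"
  using finite_local_min by (simp add: min_indices_def)

lemma min_indices_less:
  "i < j \<Longrightarrow> j < length (min_indices g M) \<Longrightarrow> min_indices g M ! i < min_indices g M ! j"
  unfolding min_indices_def by (rule sorted_wrt_nth_less[OF strict_sorted_list_of_set])

lemma local_min_nth: "i < length (min_indices g M) \<Longrightarrow> local_min_index g M (min_indices g M ! i)"
  using set_min_indices nth_mem by blast

lemma local_min_cases:
  assumes "local_min_index g M l" "i < length (min_indices g M)"
  shows "l = min_indices g M ! i \<or> (\<exists>j<i. l = min_indices g M ! j) \<or>
    (Suc i < length (min_indices g M) \<and> min_indices g M ! Suc i \<le> l)"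
proof -
  obtain j where j: "j < length (min_indices g M)" "l = min_indices g M ! j"
    using assms(1) set_min_indices by (metis in_set_conv_nth)
  consider "j < i" | "j = i" | "j = Suc i" | "Suc i < j" by linarith
  then show ?thesis
  proof cases
    case 4
    then have "min_indices g M ! Suc i < l" using j min_indices_less by blast
    then show ?thesis using 4 j by auto
  qed (use j in auto)
qed

lemma no_local_min_before_first:
  "local_min_index g M l \<Longrightarrow> 0 < length (min_indices g M) \<Longrightarrow> min_indices g M ! 0 \<le> l"
  using local_min_cases[of g M l 0] min_indices_less[of 0 1 g M] by auto

lemma no_local_min_between:
  assumes "local_min_index g M l" "Suc i < length (min_indices g M)" "min_indices g M ! i < l"
  shows "min_indices g M ! Suc i \<le> l"
  using local_min_cases[OF assms(1), of i] assms(2,3) min_indices_less[of _ i g M] by fastforce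

lemma no_local_min_after_last:
  assumes "local_min_index g M l" "length (min_indices g M) = Suc i"
  shows "l \<le> min_indices g M ! i"
  using local_min_cases[OF assms(1), of i] assms(2) min_indices_less[of _ i g M]
  by (auto intro: less_imp_le)

lemma ex1_local_max_between:
  assumes i: "Suc i < length (min_indices g M)"
  shows "\<exists>!n. local_max_index g M n \<and> min_indices g M ! i < n \<and> n < min_indices g M ! Suc i"
proof (rule ex_ex1I)
  show "\<exists>n. local_max_index g M n \<and> min_indices g M ! i < n \<and> n < min_indices g M ! Suc i"
    using local_max_between_local_min[OF local_min_nth local_min_nth[OF i] min_indices_less[OF _ i], of i] i
    by auto
next
  fix n n'
  assume n: "local_max_index g M n \<and> min_indices g M ! i < n \<and> n < min_indices g M ! Suc i"
    and n': "local_max_index g M n' \<and> min_indices g M ! i < n' \<and> n' < min_indices g M ! Suc i"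
  have False if a: "local_max_index g M a" "min_indices g M ! i < a"
    and b: "local_max_index g M b" "b < min_indices g M ! Suc i" and "a < b" for a b
  proof -
    obtain l where "a < l" "l < b" "local_min_index g M l"
      using local_min_between_local_max[OF a(1) disjI1[OF b(1)] \<open>a < b\<close>] b(1) by blast
    then show False using no_local_min_between[OF _ i, of l] a b by simp
  qed
  then show "n = n'" using n n' by (meson linorder_neqE_nat)
qed

text \<open>
The positions on the grid of the parameters \<open>alpha_max\<close>: they separate the local minima and include
both ends of the sequence.
\<close>

definition max_position :: "(nat \<Rightarrow> real) \<Rightarrow> nat \<Rightarrow> nat \<Rightarrow> nat" where
  "max_position g M k =
     (if k = 0 then 0
      else if k = length (min_indices g M) then M
      else (THE n. local_max_index g M n \<and> min_indices g M ! (k - 1) < n \<and> n < min_indices g M ! k))"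

lemma max_position_inner:
  assumes "0 < k" "k < length (min_indices g M)"
  shows "local_max_index g M (max_position g M k)"
    and "min_indices g M ! (k - 1) < max_position g M k" and "max_position g M k < min_indices g M ! k"
  using theI'[OF ex1_local_max_between[of "k - 1" g M]] assms by (simp_all add: max_position_def)

lemma max_position_unique:
  assumes k: "0 < k" "k < length (min_indices g M)"
    and n: "local_max_index g M n" "min_indices g M ! (k - 1) < n" "n < min_indices g M ! k"
  shows "n = max_position g M k"
proof -
  have "\<exists>!n. local_max_index g M n \<and> min_indices g M ! (k - 1) < n \<and> n < min_indices g M ! k"
    using ex1_local_max_between[of "k - 1" g M] k by simp
  then show ?thesis using n max_position_inner[OF k] by blast
qed

lemma max_position_bounds:
  assumes "0 < k" "k \<le> length (min_indices g M)"
  shows "max_position g M (k - 1) \<le> min_indices g M ! (k - 1)"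
    and "min_indices g M ! (k - 1) \<le> max_position g M k"
    and "max_position g M k \<le> M"
proof -
  have m: "local_min_index g M (min_indices g M ! (k - 1))" using assms by (intro local_min_nth) simp
  show "max_position g M (k - 1) \<le> min_indices g M ! (k - 1)"
  proof (cases "k = 1")
    case True
    then show ?thesis by (simp add: max_position_def)
  next
    case False
    then have "0 < k - 1" "k - 1 < length (min_indices g M)" using assms by auto
    then show ?thesis using max_position_inner(3)[of "k - 1" g M] by simp
  qed
  have "min_indices g M ! (k - 1) \<le> max_position g M k \<and> max_position g M k \<le> M"
  proof (cases "k = length (min_indices g M)")
    case True
    then have "max_position g M k = M" using assms by (simp add: max_position_def)
    then show ?thesis using m by (auto simp: local_min_index_iff)
  next
    case False
    then have "k < length (min_indices g M)" using assms by simp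
    note inner = max_position_inner[OF assms(1) this]
    have "max_position g M k < M" using inner(1) by (simp add: local_max_index_iff)
    then show ?thesis using inner(2) by simp
  qed
  then show "min_indices g M ! (k - 1) \<le> max_position g M k" "max_position g M k \<le> M" by blast+
qed

text \<open>Between consecutive separating positions the sequence falls to its local minimum and rises
afterwards, so on the way from \<open>j\<close> to the minimum no value exceeds \<open>g j\<close>.\<close>

lemma valley_side_le:
  fixes g :: "nat \<Rightarrow> real"
  assumes start: "\<not> rises_from_initial_plateau g M"
    and k: "0 < k" "k \<le> length (min_indices g M)"
    and j: "max_position g M (k - 1) \<le> j" "j \<le> max_position g M k"
    and i: "min j (min_indices g M ! (k - 1)) \<le> i" "i \<le> max j (min_indices g M ! (k - 1))"
  shows "g i \<le> g j"
proof -
  define m where "m = min_indices g M ! (k - 1)"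
  note bounds = max_position_bounds[OF k, folded m_def]
  have m: "local_min_index g M m" unfolding m_def using k by (intro local_min_nth) simp
  then have mM: "m \<le> M" by (auto simp: local_min_index_iff)
  show ?thesis
  proof (cases "j \<le> m")
    case True
    show ?thesis
    proof (rule antimono_before_local_min)
      show "local_max_index g M (max_position g M (k - 1)) \<or>
          (max_position g M (k - 1) = 0 \<and> \<not> rises_from_initial_plateau g M)"
        using max_position_inner(1)[of "k - 1" g M] start k
        by (cases "k = 1") (auto simp: max_position_def)
      show "\<not> local_min_index g M l" if "max_position g M (k - 1) \<le> l" "l < m" for l
      proof
        assume l: "local_min_index g M l"
        show False
        proof (cases "k = 1")
          case True
          have "0 < length (min_indices g M)" using k by linarith
          then show False using no_local_min_before_first[OF l] that \<open>k = 1\<close> by (simp add: m_def)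
        next
          case False
          then have "0 < k - 1" "k - 1 < length (min_indices g M)" using k by auto
          then have "min_indices g M ! (k - 2) < l"
            using max_position_inner(2)[of "k - 1" g M] that by (simp add: numeral_2_eq_2)
          moreover have "Suc (k - 2) = k - 1" using False k by simp
          ultimately show False
            using no_local_min_between[OF l, of "k - 2"] \<open>k - 1 < _\<close> that by (simp add: m_def)
        qed
      qed
    qed (use True i j mM in \<open>auto simp: m_def\<close>)
  next
    case False
    show ?thesis
    proof (rule mono_after_local_min[OF m])
      show "\<not> local_max_index g M l" if l: "m < l" "l < max_position g M k" for l
      proof
        assume max: "local_max_index g M l"
        show False
        proof (cases "k = length (min_indices g M)")
          case True
          have "l < M" using max by (simp add: local_max_index_iff)
          then obtain l' where "l < l'" "local_min_index g M l'"
            using local_min_between_local_max[OF max, of M] by blast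
          then show False using no_local_min_after_last[of g M l' "k - 1"] l True k by (simp add: m_def)
        next
          case False
          then have kK: "k < length (min_indices g M)" using k by simp
          have "l < min_indices g M ! k" using max_position_inner(3)[OF k(1) kK] l by simp
          then have "l = max_position g M k"
            using l by (intro max_position_unique[OF k(1) kK max]) (simp_all add: m_def)
          then show False using l by simp
        qed
      qed
    qed (use False i j bounds in \<open>auto simp: m_def\<close>)
  qed
qed

section \<open>Error of the best local minimum point\<close>

context
  fixes q :: real and A :: "'h::{real_inner,complete_space} \<Rightarrow> 'f::{real_inner,complete_space}"
    and f :: 'f and u :: 'h and \<alpha> :: "nat \<Rightarrow> real" and M :: nat
  assumes q: "0 < q" "q < 1" and A: "bounded_linear A"
    and \<alpha>0: "0 < \<alpha> 0" and \<alpha>_step: "\<forall>j\<in>{1..M}. \<alpha> j = q * \<alpha> (j - 1)"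
    and L_min: "L_min A f \<alpha> M \<noteq> {}"
begin

private definition g :: "nat \<Rightarrow> real" where "g j = psiQ A f (\<alpha> j)"
private abbreviation (input) "K \<equiv> length (min_indices g M)"

lemma psiQ_grid: "(\<lambda>j. psiQ A f (\<alpha> j)) = g"
  by (simp add: fun_eq_iff g_def)

lemma grid_Suc: "j < M \<Longrightarrow> \<alpha> (Suc j) = q * \<alpha> j"
  using \<alpha>_step by simp

lemma grid_power: "j \<le> M \<Longrightarrow> \<alpha> j = q ^ j * \<alpha> 0"
  by (induction j) (simp_all add: grid_Suc)

lemma grid_pos: "j \<le> M \<Longrightarrow> 0 < \<alpha> j"
  using q \<alpha>0 grid_power[of j] by simp

lemma grid_less_iff: "i \<le> M \<Longrightarrow> j \<le> M \<Longrightarrow> \<alpha> j < \<alpha> i \<longleftrightarrow> i < j"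
  using q \<alpha>0 grid_power[of i] grid_power[of j] by simp

lemma grid_le_iff: "i \<le> M \<Longrightarrow> j \<le> M \<Longrightarrow> \<alpha> j \<le> \<alpha> i \<longleftrightarrow> i \<le> j"
  using grid_less_iff[of j i] by (simp flip: not_less)

lemma min_indices_le: "l \<in> set (min_indices g M) \<Longrightarrow> l \<le> M"
  by (auto simp: set_min_indices local_min_index_iff)

lemma L_min_set: "L_min A f \<alpha> M = \<alpha> ` set (min_indices g M)"
  unfolding L_min_def psiQ_grid by (auto simp: set_min_indices)

text \<open>The grid decreases, so listing the minimum points from the largest to the smallest is listing their
indices in increasing order. From here on all parameters are replaced by their indices.\<close>

lemma L_min_sorted: "rev (sorted_list_of_set (L_min A f \<alpha> M)) = map \<alpha> (min_indices g M)"
proof -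
  have "sorted_wrt (<) (min_indices g M)" unfolding min_indices_def by (rule strict_sorted_list_of_set)
  then have "sorted_wrt (\<lambda>i j. \<alpha> j < \<alpha> i) (min_indices g M)"
    by (rule sorted_wrt_mono_rel[rotated]) (simp add: grid_less_iff min_indices_le)
  then have "sorted_wrt (<) (rev (map \<alpha> (min_indices g M)))"
    by (simp add: sorted_wrt_rev sorted_wrt_map)
  then have "sorted_list_of_set (L_min A f \<alpha> M) = rev (map \<alpha> (min_indices g M))"
    unfolding L_min_set
    by (intro strict_sorted_equal strict_sorted_list_of_set) (simp_all add: finite_imageI)
  then show ?thesis by simp
qed

lemma K_min_eq: "K_min A f \<alpha> M = K"
proof -
  have "length (sorted_list_of_set (L_min A f \<alpha> M)) = K"
    using arg_cong[OF L_min_sorted, of length] by simp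
  then show ?thesis by (simp add: K_min_def)
qed

lemma K_pos: "0 < K"
  using L_min unfolding L_min_set by auto

lemma alpha_min_eq: "0 < k \<Longrightarrow> k \<le> K \<Longrightarrow> alpha_min A f \<alpha> M k = \<alpha> (min_indices g M ! (k - 1))"
  unfolding alpha_min_def L_min_sorted by (simp add: nth_map)

lemma max_position_le: "k \<le> K \<Longrightarrow> max_position g M k \<le> M"
  using max_position_bounds(3)[of k g M] by (cases "k = 0") (auto simp: max_position_def)

lemma alpha_max_eq:
  assumes "k \<le> K"
  shows "alpha_max A f \<alpha> M k = \<alpha> (max_position g M k)"
proof (cases "k = 0 \<or> k = K")
  case True
  then show ?thesis using K_pos by (auto simp: alpha_max_def max_position_def K_min_eq)
next
  case False
  then have k: "0 < k" "k < K" using assms by auto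
  note inner = max_position_inner[OF k]
  have le: "min_indices g M ! (k - 1) \<le> M" "min_indices g M ! k \<le> M"
    using k by (auto intro!: min_indices_le)
  let ?P = "\<lambda>\<beta>. \<beta> \<in> L_max A f \<alpha> M \<and> alpha_min A f \<alpha> M (k + 1) < \<beta> \<and> \<beta> < alpha_min A f \<alpha> M k"
  have mins: "alpha_min A f \<alpha> M (k + 1) = \<alpha> (min_indices g M ! k)"
    "alpha_min A f \<alpha> M k = \<alpha> (min_indices g M ! (k - 1))"
    using k by (simp_all add: alpha_min_eq)
  have L_max: "L_max A f \<alpha> M = \<alpha> ` {n. local_max_index g M n}"
    unfolding L_max_def psiQ_grid ..
  have "(THE \<beta>. ?P \<beta>) = \<alpha> (max_position g M k)"
  proof (rule the_equality)
    show "?P (\<alpha> (max_position g M k))"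
      using inner le max_position_le[OF assms] unfolding mins L_max by (auto simp: grid_less_iff)
    fix \<beta> assume "?P \<beta>"
    then obtain n where n: "\<beta> = \<alpha> n" "local_max_index g M n"
      "\<alpha> (min_indices g M ! k) < \<alpha> n" "\<alpha> n < \<alpha> (min_indices g M ! (k - 1))"
      unfolding mins L_max by blast
    have "n \<le> M" using n(2) by (simp add: local_max_index_iff)
    then have "min_indices g M ! (k - 1) < n" "n < min_indices g M ! k"
      using n le by (simp_all add: grid_less_iff)
    then have "n = max_position g M k" by (intro max_position_unique k n(2))
    then show "\<beta> = \<alpha> (max_position g M k)" using n by simp
  qed
  then show ?thesis using k by (simp add: alpha_max_def K_min_eq)
qed

private definition valley_quotients :: "nat \<Rightarrow> real set" where
  "valley_quotients k = (\<lambda>j. T_quot A f (\<alpha> (min_indices g M ! (k - 1))) (\<alpha> j)) `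
     {max_position g M (k - 1)..max_position g M k}"

lemma C_const_eq: "C_const A f \<alpha> M = 1 + Max ((\<lambda>k. Max (valley_quotients k)) ` {1..K})"
proof -
  have "(\<lambda>\<beta>. T_quot A f (alpha_min A f \<alpha> M k) \<beta>) `
      {\<beta> \<in> \<alpha> ` {0..M}. alpha_max A f \<alpha> M k \<le> \<beta> \<and> \<beta> \<le> alpha_max A f \<alpha> M (k - 1)} =
    valley_quotients k" if "k \<in> {1..K}" for k
  proof -
    have k: "0 < k" "k \<le> K" "k - 1 \<le> K" using that by auto
    have "{\<beta> \<in> \<alpha> ` {0..M}. alpha_max A f \<alpha> M k \<le> \<beta> \<and> \<beta> \<le> alpha_max A f \<alpha> M (k - 1)} =
        \<alpha> ` {max_position g M (k - 1)..max_position g M k}"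
      unfolding alpha_max_eq[OF k(2)] alpha_max_eq[OF k(3)]
      using max_position_le[OF k(2)] max_position_le[OF k(3)]
      by (auto simp: grid_le_iff intro!: imageI)
    then show ?thesis by (simp add: image_image alpha_min_eq k valley_quotients_def)
  qed
  then show ?thesis unfolding C_const_def K_min_eq
    by (intro arg_cong[where f = "\<lambda>X. 1 + Max X"] image_cong refl) simp
qed

lemma T_quot_le_C_const:
  assumes "0 < k" "k \<le> K" "max_position g M (k - 1) \<le> j" "j \<le> max_position g M k"
  shows "1 + T_quot A f (\<alpha> (min_indices g M ! (k - 1))) (\<alpha> j) \<le> C_const A f \<alpha> M"
proof -
  have "T_quot A f (\<alpha> (min_indices g M ! (k - 1))) (\<alpha> j) \<le> Max (valley_quotients k)"
    unfolding valley_quotients_def using assms by (intro Max_ge) auto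
  also have "\<dots> \<le> Max ((\<lambda>k. Max (valley_quotients k)) ` {1..K})"
    using assms by (intro Max_ge) auto
  finally show ?thesis unfolding C_const_eq by simp
qed

text \<open>The separating positions start at \<open>0\<close> and end at \<open>M\<close>, so the first one that reaches \<open>j\<close> closes an
interval containing \<open>j\<close>.\<close>

lemma bracketing_interval:
  assumes "j \<le> M"
  shows "\<exists>k. 0 < k \<and> k \<le> K \<and> max_position g M (k - 1) \<le> j \<and> j \<le> max_position g M k"
proof -
  define k where "k = (LEAST k. 0 < k \<and> j \<le> max_position g M k)"
  have K: "0 < K \<and> j \<le> max_position g M K" using K_pos assms by (simp add: max_position_def)
  have k: "0 < k \<and> j \<le> max_position g M k" unfolding k_def by (rule LeastI[of _ K]) (rule K)
  have "k \<le> K" unfolding k_def by (rule Least_le) (rule K)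
  moreover have "max_position g M (k - 1) \<le> j"
  proof (cases "k = 1")
    case True
    then show ?thesis by (simp add: max_position_def)
  next
    case False
    then have "0 < k - 1" "k - 1 < k" using k by auto
    then show ?thesis using not_less_Least[of "k - 1" "\<lambda>k. 0 < k \<and> j \<le> max_position g M k"]
      by (simp add: k_def)
  qed
  ultimately show ?thesis using k by blast
qed

lemma C_const_ge_1: "1 \<le> C_const A f \<alpha> M"
proof -
  obtain k where k: "0 < k \<and> k \<le> K \<and> max_position g M (k - 1) \<le> 0 \<and> 0 \<le> max_position g M k"
    using bracketing_interval[of 0] by auto
  have "0 \<le> T_quot A f (\<alpha> (min_indices g M ! (k - 1))) (\<alpha> 0)"
    using psiQ_nonneg[OF A \<alpha>0] by (simp add: T_quot_def)
  then show ?thesis using T_quot_le_C_const[of k 0] k by simp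
qed

text \<open>Compare with the minimum point of the interval containing \<open>\<alpha> j\<close>: the distance to it is
\<open>\<psi>\<^sub>Q(\<alpha> j)\<close> times the corresponding value of \<open>T_quot\<close>, and both \<open>\<psi>\<^sub>Q(\<alpha> j)\<close> and the error at \<open>\<alpha> j\<close> are at most
\<open>e\<^sub>1(\<alpha> j)\<close>.\<close>

lemma grid_error_le:
  assumes j: "j \<le> M"
  shows "Min ((\<lambda>a. norm (tikhonov A f a - u)) ` L_min A f \<alpha> M) \<le> C_const A f \<alpha> M * e1 A (A u) f u (\<alpha> j)"
proof -
  obtain k where k: "0 < k" "k \<le> K" "max_position g M (k - 1) \<le> j" "j \<le> max_position g M k"
    using bracketing_interval[OF j] by blast
  define a where "a = \<alpha> (min_indices g M ! (k - 1))"
  have mem: "min_indices g M ! (k - 1) \<in> set (min_indices g M)" using k by simp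
  have a: "0 < a" unfolding a_def by (intro grid_pos min_indices_le mem)
  have b: "0 < \<alpha> j" by (rule grid_pos[OF j])
  have "Min ((\<lambda>a. norm (tikhonov A f a - u)) ` L_min A f \<alpha> M) \<le> norm (tikhonov A f a - u)"
    using mem unfolding L_min_set a_def by (intro Min_le) auto
  also have "\<dots> \<le> norm (tikhonov A f (\<alpha> j) - u) + norm (tikhonov A f a - tikhonov A f (\<alpha> j))"
    using norm_triangle_ineq[of "tikhonov A f (\<alpha> j) - u" "tikhonov A f a - tikhonov A f (\<alpha> j)"] by simp
  also have "norm (tikhonov A f a - tikhonov A f (\<alpha> j)) = T_quot A f a (\<alpha> j) * psiQ A f (\<alpha> j)"
    using tikhonov_zero_if_psiQ_zero[OF A b, of _ f] a b
    by (cases "psiQ A f (\<alpha> j) = 0") (simp_all add: T_quot_def)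
  also have "norm (tikhonov A f (\<alpha> j) - u) + T_quot A f a (\<alpha> j) * psiQ A f (\<alpha> j) \<le>
      e1 A (A u) f u (\<alpha> j) + T_quot A f a (\<alpha> j) * e1 A (A u) f u (\<alpha> j)"
    using psiQ_nonneg[OF A b, of f]
    by (intro add_mono mult_left_mono error_le_e1 psiQ_le_e1 A b) (simp add: T_quot_def)
  also have "\<dots> = (1 + T_quot A f a (\<alpha> j)) * e1 A (A u) f u (\<alpha> j)" by (simp add: algebra_simps)
  also have "\<dots> \<le> C_const A f \<alpha> M * e1 A (A u) f u (\<alpha> j)"
    using T_quot_le_C_const[OF k] by (intro mult_right_mono) (simp_all add: a_def e1_def)
  finally show ?thesis .
qed

lemma grid_bracket:
  assumes "\<alpha> M \<le> a" "a \<le> \<alpha> 0"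
  shows "\<exists>j\<le>M. a \<le> \<alpha> j \<and> q * \<alpha> j \<le> a"
proof -
  define j where "j = (GREATEST j. j \<le> M \<and> a \<le> \<alpha> j)"
  have j: "j \<le> M \<and> a \<le> \<alpha> j" unfolding j_def
    by (rule GreatestI_nat[of _ 0 M]) (use assms in auto)
  have "q * \<alpha> j \<le> a"
  proof (cases "j = M")
    case True
    have "q * \<alpha> M \<le> \<alpha> M" using q grid_pos[of M] by (simp add: mult_left_le_one_le)
    then show ?thesis using True assms by simp
  next
    case False
    have "\<not> a \<le> \<alpha> (Suc j)"
    proof
      assume "a \<le> \<alpha> (Suc j)"
      then have "Suc j \<le> j" unfolding j_def
        by (intro Greatest_le_nat[of _ _ M]) (use j False in \<open>auto simp: j_def[symmetric]\<close>)
      then show False by simp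
    qed
    then show ?thesis using grid_Suc[of j] j False by simp
  qed
  then show ?thesis using j by blast
qed

text \<open>Rounding \<open>a\<close> up to the grid costs the factor \<open>1/q\<close>.\<close>

lemma min_error_le_e1:
  assumes "\<alpha> M \<le> a" "a \<le> \<alpha> 0"
  shows "Min ((\<lambda>a. norm (tikhonov A f a - u)) ` L_min A f \<alpha> M)
    \<le> inverse q * C_const A f \<alpha> M * e1 A (A u) f u a"
proof -
  obtain j where j: "j \<le> M" "a \<le> \<alpha> j" "q * \<alpha> j \<le> a" using grid_bracket[OF assms] by blast
  have a: "0 < a" using grid_pos[of M] assms by simp
  have "e1 A (A u) f u (\<alpha> j) \<le> (\<alpha> j / a) * e1 A (A u) f u a" by (rule e1_le_scaled[OF A a j(2)])
  also have "\<dots> \<le> inverse q * e1 A (A u) f u a"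
    using j a q by (intro mult_right_mono) (simp_all add: e1_def field_simps)
  finally have "C_const A f \<alpha> M * e1 A (A u) f u (\<alpha> j) \<le> C_const A f \<alpha> M * (inverse q * e1 A (A u) f u a)"
    using C_const_ge_1 by (intro mult_left_mono) auto
  then show ?thesis using grid_error_le[OF j(1)] by (simp add: mult_ac)
qed

lemma min_error_le_Inf_e1:
  "Min ((\<lambda>a. norm (tikhonov A f a - u)) ` L_min A f \<alpha> M)
    \<le> inverse q * C_const A f \<alpha> M * (INF a\<in>{\<alpha> M..\<alpha> 0}. e1 A (A u) f u a)"
proof -
  define c m where "c = inverse q * C_const A f \<alpha> M"
    and "m = Min ((\<lambda>a. norm (tikhonov A f a - u)) ` L_min A f \<alpha> M)"
  have c: "0 < c" using q C_const_ge_1 by (simp add: c_def)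
  have "m / c \<le> (INF a\<in>{\<alpha> M..\<alpha> 0}. e1 A (A u) f u a)"
  proof (rule cINF_greatest)
    show "{\<alpha> M..\<alpha> 0} \<noteq> {}" by (simp add: grid_le_iff)
    show "m / c \<le> e1 A (A u) f u a" if "a \<in> {\<alpha> M..\<alpha> 0}" for a
      using min_error_le_e1[of a, folded c_def m_def] that c by (simp add: pos_divide_le_eq mult.commute)
  qed
  then show ?thesis using c unfolding c_def[symmetric] m_def[symmetric]
    by (simp add: pos_divide_le_eq mult.commute)
qed

lemma tikhonov_path_le:
  assumes "i \<le> j" "j \<le> M" and bound: "\<And>l. i \<le> l \<Longrightarrow> l \<le> j \<Longrightarrow> g l \<le> c"
  shows "norm (tikhonov A f (\<alpha> j) - tikhonov A f (\<alpha> i)) \<le> real (j - i) * ((inverse q - 1) * c)"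
  using assms
proof (induction j rule: dec_induct)
  case base
  show ?case by simp
next
  case (step l)
  have l: "l < M" "0 < \<alpha> l" using step grid_pos[of l] by auto
  have "norm (tikhonov A f (\<alpha> (Suc l)) - tikhonov A f (\<alpha> l)) \<le> (\<alpha> l / \<alpha> (Suc l) - 1) * g l"
    unfolding g_def using q l step.prems grid_le_iff[of l "Suc l"]
    by (intro norm_tikhonov_step_le A grid_pos) auto
  also have "\<alpha> l / \<alpha> (Suc l) = inverse q" using l q by (simp add: grid_Suc field_simps)
  also have "(inverse q - 1) * g l \<le> (inverse q - 1) * c"
    using q step by (intro mult_left_mono) (auto simp: one_le_inverse)
  finally have "norm (tikhonov A f (\<alpha> (Suc l)) - tikhonov A f (\<alpha> l)) \<le> (inverse q - 1) * c" .
  moreover have "norm (tikhonov A f (\<alpha> l) - tikhonov A f (\<alpha> i)) \<le> real (l - i) * ((inverse q - 1) * c)"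
    using step by auto
  moreover have "real (Suc l - i) * ((inverse q - 1) * c) = real (l - i) * ((inverse q - 1) * c) + (inverse q - 1) * c"
    using step by (simp add: Suc_diff_le algebra_simps)
  ultimately show ?case
    using norm_triangle_ineq[of "tikhonov A f (\<alpha> (Suc l)) - tikhonov A f (\<alpha> l)" "tikhonov A f (\<alpha> l) - tikhonov A f (\<alpha> i)"]
    by simp
qed

lemma ln_grid_ratio: "c_grid q * ln (\<alpha> 0 / \<alpha> M) = real M * (inverse q - 1)"
proof -
  have "\<alpha> 0 / \<alpha> M = inverse q ^ M" using q \<alpha>0 grid_power[of M] by (simp add: field_simps)
  moreover have "ln (inverse q) > 0" using q by (simp add: one_less_inverse)
  ultimately show ?thesis using q by (simp add: c_grid_def ln_realpow)
qed

text \<open>On the way from \<open>\<alpha> j\<close> to the minimum point of its valley there are at most \<open>M\<close> steps, each of length at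
most \<open>(1/q - 1) \<psi>\<^sub>Q(\<alpha> j)\<close>; and \<open>M (1/q - 1)\<close> is the logarithmic bound in disguise.\<close>

lemma C_const_le:
  assumes start: "\<not> rises_from_initial_plateau (\<lambda>j. psiQ A f (\<alpha> j)) M"
  shows "C_const A f \<alpha> M \<le> 1 + c_grid q * ln (\<alpha> 0 / \<alpha> M)"
proof -
  let ?B = "real M * (inverse q - 1)"
  have q': "0 \<le> inverse q - 1" using q by (simp add: one_le_inverse)
  have start': "\<not> rises_from_initial_plateau g M" using start unfolding psiQ_grid .
  have T_le: "T_quot A f (\<alpha> (min_indices g M ! (k - 1))) (\<alpha> j) \<le> ?B"
    if k: "0 < k" "k \<le> K" and j: "max_position g M (k - 1) \<le> j" "j \<le> max_position g M k" for k j
  proof -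
    define m where "m = min_indices g M ! (k - 1)"
    have mM: "m \<le> M" unfolding m_def using k by (intro min_indices_le) simp
    have jM: "j \<le> M" using j max_position_le[OF k(2)] by simp
    have g: "0 \<le> g j" unfolding g_def by (intro psiQ_nonneg A grid_pos jM)
    have valley: "g i \<le> g j" if "min j m \<le> i" "i \<le> max j m" for i
      using valley_side_le[OF start' k j] that unfolding m_def by blast
    have "norm (tikhonov A f (\<alpha> m) - tikhonov A f (\<alpha> j)) \<le> real (max j m - min j m) * ((inverse q - 1) * g j)"
    proof (cases "j \<le> m")
      case True
      then show ?thesis using tikhonov_path_le[of j m "g j"] valley mM by simp
    next
      case False
      then show ?thesis using tikhonov_path_le[of m j "g j"] valley jM by (simp add: norm_minus_commute)
    qed
    also have "\<dots> \<le> real M * ((inverse q - 1) * g j)"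
      using mM jM g q' by (intro mult_right_mono) auto
    finally have "norm (tikhonov A f (\<alpha> m) - tikhonov A f (\<alpha> j)) \<le> ?B * g j" by (simp add: mult.assoc)
    then show ?thesis using g q' by (cases "g j = 0") (simp_all add: T_quot_def m_def g_def[symmetric] divide_le_eq)
  qed
  have "Max ((\<lambda>k. Max (valley_quotients k)) ` {1..K}) \<le> ?B"
  proof (rule Max.boundedI)
    fix y assume "y \<in> (\<lambda>k. Max (valley_quotients k)) ` {1..K}"
    then obtain k where y: "y = Max (valley_quotients k)" and "k \<in> {1..K}" by (rule imageE)
    then have k: "0 < k" "k \<le> K" by auto
    have "max_position g M (k - 1) \<le> max_position g M k"
      using max_position_bounds(1,2)[OF k] by simp
    then show "y \<le> ?B"
      unfolding y valley_quotients_def using T_le[OF k] by (intro Max.boundedI) auto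
  qed (use K_pos in \<open>auto simp: Suc_le_eq\<close>)
  then show ?thesis unfolding C_const_eq ln_grid_ratio by simp
qed

end

section \<open>Limit of the grid constant and convergence rate\<close>

text \<open>Up to the factor \<open>1/q\<close>, \<open>c_grid\<close> is the reciprocal of the difference quotient of \<open>ln\<close> at \<open>1\<close>.\<close>

lemma c_grid_tendsto_1: "(c_grid \<longlongrightarrow> 1) (at_left 1)"
proof -
  have "((\<lambda>q. (ln q - ln 1) / (q - 1)) \<longlongrightarrow> inverse 1) (at (1::real))"
    using DERIV_ln[of "1::real"] by (simp add: has_field_derivative_iff)
  then have "((\<lambda>q. inverse q * inverse ((ln q - ln 1) / (q - 1))) \<longlongrightarrow> inverse 1 * inverse (inverse 1)) (at (1::real))"
    by (intro tendsto_intros) auto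
  then have lim: "((\<lambda>q. inverse q * inverse ((ln q - ln 1) / (q - 1))) \<longlongrightarrow> 1) (at_left (1::real))"
    using tendsto_within_subset[of _ _ 1 UNIV] by auto
  have "\<forall>\<^sub>F q::real in at_left 1. 0 < q"
    using eventually_at_left_real[of 0 1] by (auto elim: eventually_mono)
  then have "\<forall>\<^sub>F q in at_left 1. inverse q * inverse ((ln q - ln 1) / (q - 1)) = c_grid q"
  proof eventually_elim
    case (elim q)
    have "c_grid q = - (inverse q - 1) / ln q"
      by (simp only: c_grid_def ln_inverse flip: minus_divide_left minus_divide_right)
    moreover have "- (inverse q - 1) = inverse q * (q - 1)" using elim by (simp add: right_diff_distrib)
    ultimately have "c_grid q = (inverse q * (q - 1)) / ln q" by simp
    then show ?case by (simp add: field_simps)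
  qed
  with lim show ?thesis by (rule Lim_transform_eventually)
qed

text \<open>The choice \<open>b = (\<delta>/\<rho>)\<^bsup>2/(p+1)\<^esup>\<close> makes both summands equal to \<open>\<rho>\<^bsup>1/(p+1)\<^esup> \<delta>\<^bsup>p/(p+1)\<^esup>\<close>. Clipping \<open>b\<close> to the
admissible interval \<open>[\<delta>0\<^sup>2, 1]\<close> changes it by at most a factor \<open>L\<close>, by the two bounds on \<open>\<rho>\<close>, and
the summands depend on the parameter through powers with exponents of modulus at most \<open>1\<close>.\<close>

lemma apriori_parameter:
  fixes p \<kappa> \<rho> \<delta> \<delta>0 :: real
  assumes p: "0 < p" "p \<le> 2" and pos: "0 < \<kappa>" "0 < \<delta>" "0 < \<delta>0" "\<delta>0 \<le> 1" "0 < \<rho>"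
    and upper: "\<kappa> * \<delta> \<le> \<rho>" and lower: "\<kappa> * \<rho> * \<delta>0 powr (p + 1) \<le> \<delta>"
  defines "L \<equiv> max 1 (\<kappa> powr (- 2 / (p + 1)))"
  shows "\<exists>a. \<delta>0\<^sup>2 \<le> a \<and> a \<le> 1 \<and>
    a powr (p / 2) * \<rho> + \<delta> / sqrt a \<le> 2 * L * (\<rho> powr (1 / (p + 1)) * \<delta> powr (p / (p + 1)))"
proof -
  define s where "s = 2 / (p + 1)"
  define b where "b = (\<delta> / \<rho>) powr s"
  define a where "a = max (\<delta>0\<^sup>2) (min 1 b)"
  define W where "W = \<rho> powr (1 / (p + 1)) * \<delta> powr (p / (p + 1))"
  have s: "0 < s" using p by (simp add: s_def)
  have b: "0 < b" using pos by (simp add: b_def)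
  have \<delta>0: "0 < \<delta>0\<^sup>2" "\<delta>0\<^sup>2 \<le> 1" using pos by (simp_all add: power_le_one)
  have a: "\<delta>0\<^sup>2 \<le> a" "a \<le> 1" "0 < a" using \<delta>0 by (auto simp: a_def less_max_iff_disj)
  have L: "1 \<le> L" "\<kappa> powr (- s) \<le> L" by (auto simp: L_def s_def)
  have "b \<le> (1 / \<kappa>) powr s"
    unfolding b_def using pos upper s by (intro powr_mono2) (auto simp: field_simps)
  also have "\<dots> = \<kappa> powr (- s)" using pos by (simp add: powr_minus powr_divide field_simps)
  finally have bL: "b \<le> L" using L by simp
  have "\<delta>0\<^sup>2 = (\<delta>0 powr (p + 1)) powr s"
  proof -
    have "(p + 1) * s = 2" 
      unfolding s_def using p by (metis add_pos_pos less_numeral_extra(1,3) nonzero_mult_div_cancel_left times_divide_eq_right)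
    then show ?thesis using pos by (simp add: powr_powr)
  qed
  also have "\<dots> \<le> ((\<delta> / \<rho>) * (1 / \<kappa>)) powr s"
    using pos lower s by (intro powr_mono2) (auto simp: field_simps)
  also have "\<dots> = b * \<kappa> powr (- s)"
    using pos by (simp add: b_def powr_mult powr_minus powr_divide field_simps)
  also have "\<dots> \<le> b * L" using b L by simp
  finally have "\<delta>0\<^sup>2 \<le> L * b" by (simp add: mult.commute)
  moreover have "b \<le> L * b" using b L by simp
  ultimately have aLb: "a \<le> L * b" by (auto simp: a_def)
  have "b / L \<le> 1" "b / L \<le> b" using b bL L by (simp_all add: field_simps)
  then have bLa: "b / L \<le> a" by (auto simp: a_def)
  have pw: "L powr t \<le> L" if "t \<le> 1" for t
    using powr_mono[OF that L(1)] L by simp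
  have "a powr (p / 2) * \<rho> \<le> (L * b) powr (p / 2) * \<rho>"
    using aLb a pos p by (intro mult_right_mono powr_mono2) auto
  also have "\<dots> = L powr (p / 2) * (b powr (p / 2) * \<rho>)" using L b by (simp add: powr_mult)
  also have "b powr (p / 2) * \<rho> = W"
  proof -
    have "s * (p / 2) = p / (p + 1)" by (simp only: s_def times_divide_eq_left)
    then have "b powr (p / 2) = (\<delta> / \<rho>) powr (p / (p + 1))" by (simp only: b_def powr_powr)
    then have "b powr (p / 2) = \<delta> powr (p / (p + 1)) / \<rho> powr (p / (p + 1))"
      using pos by (simp add: powr_divide)
    moreover have "\<rho> / \<rho> powr (p / (p + 1)) = \<rho> powr (1 - p / (p + 1))"
      using pos by (simp add: powr_diff)
    moreover have "1 - p / (p + 1) = 1 / (p + 1)" using p by (simp add: field_simps)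
    ultimately show ?thesis by (simp add: W_def) (metis mult.commute times_divide_eq_right)
  qed
  also have "L powr (p / 2) * W \<le> L * W"
    using p pw[of "p / 2"] by (intro mult_right_mono) (auto simp: W_def)
  finally have first: "a powr (p / 2) * \<rho> \<le> L * W" .
  have "\<delta> / sqrt a \<le> \<delta> / sqrt (b / L)"
    using bLa a b L pos by (intro divide_left_mono) auto
  also have "\<dots> = L powr (1 / 2) * (\<delta> / b powr (1 / 2))"
    using L b by (simp add: powr_half_sqrt real_sqrt_divide)
  also have "\<delta> / b powr (1 / 2) = W"
  proof -
    have "s * (1 / 2) = 1 / (p + 1)" by (simp only: s_def times_divide_eq_left)
    then have "b powr (1 / 2) = (\<delta> / \<rho>) powr (1 / (p + 1))" by (simp only: b_def powr_powr)
    then have "b powr (1 / 2) = \<delta> powr (1 / (p + 1)) / \<rho> powr (1 / (p + 1))"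
      using pos by (simp add: powr_divide)
    moreover have "\<delta> / \<delta> powr (1 / (p + 1)) = \<delta> powr (1 - 1 / (p + 1))"
      using pos by (simp add: powr_diff)
    moreover have "1 - 1 / (p + 1) = p / (p + 1)" using p by (simp add: field_simps)
    ultimately show ?thesis by (simp add: W_def) (metis mult.commute times_divide_eq_left)
  qed
  also have "L powr (1 / 2) * W \<le> L * W"
    using pw[of "1 / 2"] by (intro mult_right_mono) (auto simp: W_def)
  finally have "\<delta> / sqrt a \<le> L * W" .
  with first have "a powr (p / 2) * \<rho> + \<delta> / sqrt a \<le> 2 * L * W" by simp
  then show ?thesis using a unfolding W_def by blast
qed

text \<open>Here \<open>ln (1/\<delta>0) = ln (\<delta>/\<delta>0) - ln \<delta>\<close>, and a sum of two quantities that are at least \<open>\<kappa>\<close>, as well as the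
constant \<open>1\<close>, is bounded by a multiple of their product.\<close>

lemma log_factor_le:
  fixes \<kappa> c \<delta> \<delta>0 :: real
  assumes "0 < \<kappa>" "0 \<le> c" "0 < \<delta>" "0 < \<delta>0" and x: "\<kappa> \<le> ln (\<delta> / \<delta>0)" and y: "\<kappa> \<le> \<bar>ln \<delta>\<bar>"
  shows "1 + c * ln (1 / \<delta>0\<^sup>2) \<le> (1 / \<kappa>\<^sup>2 + 4 * c / \<kappa>) * (ln (\<delta> / \<delta>0) * \<bar>ln \<delta>\<bar>)"
proof -
  define X Y where "X = ln (\<delta> / \<delta>0)" and "Y = \<bar>ln \<delta>\<bar>"
  have XY: "\<kappa> \<le> X" "\<kappa> \<le> Y" using x y by (simp_all add: X_def Y_def)
  have "ln (1 / \<delta>0\<^sup>2) = 2 * (X - ln \<delta>)"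
    using assms by (simp add: X_def ln_div ln_realpow)
  also have "\<dots> \<le> 2 * (X + Y)" by (simp add: Y_def)
  also have "X + Y \<le> X * Y / \<kappa> + X * Y / \<kappa>"
  proof (rule add_mono)
    show "X \<le> X * Y / \<kappa>" "Y \<le> X * Y / \<kappa>" using XY assms(1) by (simp_all add: field_simps)
  qed
  finally have "c * ln (1 / \<delta>0\<^sup>2) \<le> c * (4 * (X * Y / \<kappa>))" using assms by (intro mult_left_mono) auto
  moreover have "\<kappa> * \<kappa> \<le> X * Y" using XY assms(1) by (intro mult_mono) auto
  then have "1 \<le> X * Y / \<kappa>\<^sup>2" using assms(1) by (simp add: field_simps power2_eq_square)
  ultimately have "1 + c * ln (1 / \<delta>0\<^sup>2) \<le> X * Y / \<kappa>\<^sup>2 + c * (4 * (X * Y / \<kappa>))" by (rule add_mono[rotated])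
  also have "\<dots> = (1 / \<kappa>\<^sup>2 + 4 * c / \<kappa>) * (X * Y)" by (simp add: algebra_simps)
  finally show ?thesis by (simp add: X_def Y_def)
qed

text \<open>The first estimate is used at the single parameter of \<open>apriori_parameter\<close>; there \<open>e\<^sub>1\<close> is bounded
by the source condition and the noise level, while \<open>C_const\<close> contributes the logarithms.\<close>

lemma rate_under_source_condition:
  fixes A :: "'h::{real_inner,complete_space} \<Rightarrow> 'f::{real_inner,complete_space}"
  assumes q: "0 < q" "q < 1" and p: "0 < p" "p \<le> 2" and \<kappa>: "0 < \<kappa>"
    and prob: "tikhonov_problem q A fstar ustar \<alpha> M" and ne: "L_min A f \<alpha> M \<noteq> {}"
    and start: "\<not> rises_from_initial_plateau (\<lambda>j. psiQ A f (\<alpha> j)) M"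
    and source: "ustar = operator_powr (operator_abs A) p v" "norm v \<le> \<rho>" and \<alpha>0: "\<alpha> 0 = 1"
    and nondeg: "nondegenerate \<kappa> p \<rho> (norm (f - fstar)) (sqrt (\<alpha> M))"
    and \<delta>: "sqrt (\<alpha> M) \<le> norm (f - fstar)"
  defines "c \<equiv> inverse q * (1 / \<kappa>\<^sup>2 + 4 * c_grid q / \<kappa>) * (2 * max 1 (\<kappa> powr (- 2 / (p + 1))))"
  shows "Min ((\<lambda>a. norm (tikhonov A f a - ustar)) ` L_min A f \<alpha> M)
    \<le> c * ln (norm (f - fstar) / sqrt (\<alpha> M)) * \<rho> powr (1 / (p + 1))
        * \<bar>ln (norm (f - fstar))\<bar> * norm (f - fstar) powr (p / (p + 1))"
proof -
  define \<delta> \<delta>0 L where "\<delta> = norm (f - fstar)" and "\<delta>0 = sqrt (\<alpha> M)"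
    and "L = max 1 (\<kappa> powr (- 2 / (p + 1)))"
  define X W where "X = ln (\<delta> / \<delta>0) * \<bar>ln \<delta>\<bar>" and "W = \<rho> powr (1 / (p + 1)) * \<delta> powr (p / (p + 1))"
  have A: "bounded_linear A" and fstar: "fstar = A ustar" and pos0: "0 < \<alpha> 0"
    and step: "\<forall>j\<in>{1..M}. \<alpha> j = q * \<alpha> (j - 1)"
    using prob by (auto simp: tikhonov_problem_def min_norm_solution_def)
  note grid = q A pos0 step ne
  have \<alpha>M: "0 < \<alpha> M" "\<alpha> M \<le> 1"
    using grid_pos[OF grid, of M] grid_le_iff[OF grid, of 0 M] \<alpha>0 by auto
  then have \<delta>0: "0 < \<delta>0" "\<delta>0 \<le> 1" "\<delta>0\<^sup>2 = \<alpha> M" by (simp_all add: \<delta>0_def)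
  have \<delta>pos: "0 < \<delta>" using \<delta>0(1) \<delta> unfolding \<delta>_def \<delta>0_def by (rule less_le_trans)
  have nd: "\<kappa> \<le> ln (\<delta> / \<delta>0)" "\<kappa> \<le> \<bar>ln \<delta>\<bar>" "\<kappa> * \<delta> \<le> \<rho>" "\<kappa> * \<rho> * \<delta>0 powr (p + 1) \<le> \<delta>"
    using nondeg by (simp_all add: nondegenerate_def \<delta>_def \<delta>0_def)
  have \<rho>: "0 < \<rho>" using nd(3) \<kappa> \<delta>pos by (meson mult_pos_pos less_le_trans)
  obtain a where a: "\<alpha> M \<le> a" "a \<le> 1" and a_bound: "a powr (p / 2) * \<rho> + \<delta> / sqrt a \<le> 2 * L * W"
    using apriori_parameter[OF p \<kappa> \<delta>pos \<delta>0(1,2) \<rho> nd(3,4)] \<delta>0(3) unfolding L_def W_def by auto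
  have apos: "0 < a" using a \<alpha>M by simp
  have "e1 A fstar f ustar a = a * norm (resolvent A a ustar) + norm (resolvent A a (adjoint A (f - fstar)))"
    unfolding fstar by (rule e1_resolvent[OF A apos])
  also have "\<dots> \<le> a powr (p / 2) * norm v + \<delta> / sqrt a"
    unfolding source(1) \<delta>_def
    by (intro add_mono source_condition_error A p apos norm_resolvent_adjoint_le)
  also have "\<dots> \<le> a powr (p / 2) * \<rho> + \<delta> / sqrt a"
    using source(2) by (intro add_mono mult_left_mono) auto
  finally have e1: "e1 A fstar f ustar a \<le> 2 * L * W" using a_bound by simp
  have c_grid: "0 \<le> c_grid q" using q by (simp add: c_grid_def one_le_inverse less_imp_le)
  have "C_const A f \<alpha> M \<le> 1 + c_grid q * ln (1 / \<delta>0\<^sup>2)"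
    using C_const_le[OF grid start] by (simp add: \<alpha>0 \<delta>0(3))
  also have "\<dots> \<le> (1 / \<kappa>\<^sup>2 + 4 * c_grid q / \<kappa>) * X"
    unfolding X_def by (rule log_factor_le[OF \<kappa> c_grid \<delta>pos \<delta>0(1) nd(1,2)])
  finally have C: "C_const A f \<alpha> M \<le> (1 / \<kappa>\<^sup>2 + 4 * c_grid q / \<kappa>) * X" .
  have "Min ((\<lambda>a. norm (tikhonov A f a - ustar)) ` L_min A f \<alpha> M)
      \<le> inverse q * C_const A f \<alpha> M * e1 A fstar f ustar a"
    unfolding fstar by (rule min_error_le_e1[OF grid]) (use a \<alpha>0 in auto)
  also have "\<dots> \<le> inverse q * ((1 / \<kappa>\<^sup>2 + 4 * c_grid q / \<kappa>) * X) * (2 * L * W)"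
    using C e1 q C_const_ge_1[OF grid] order_trans[OF _ C]
    by (intro mult_mono) (auto simp: e1_def)
  also have "\<dots> = c * ln (\<delta> / \<delta>0) * \<rho> powr (1 / (p + 1)) * \<bar>ln \<delta>\<bar> * \<delta> powr (p / (p + 1))"
    unfolding c_def L_def[symmetric] X_def W_def by (simp only: mult_ac)
  finally show ?thesis unfolding \<delta>_def \<delta>0_def .
qed

theorem theorem1:
  fixes q :: real
  assumes "0 < q" and "q < 1"
  shows
    "(\<forall>(A :: 'h::{real_inner,complete_space} \<Rightarrow> 'f::{real_inner,complete_space})
        (fstar :: 'f) (f :: 'f) (ustar :: 'h) (\<alpha> :: nat \<Rightarrow> real) (M :: nat).
        tikhonov_problem q A fstar ustar \<alpha> M \<and> L_min A f \<alpha> M \<noteq> {} \<longrightarrow>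
          Min ((\<lambda>a. norm (tikhonov A f a - ustar)) ` L_min A f \<alpha> M)
            \<le> inverse q * C_const A f \<alpha> M * (INF a\<in>{\<alpha> M..\<alpha> 0}. e1 A fstar f ustar a) \<and>
          (\<not> rises_from_initial_plateau (\<lambda>j. psiQ A f (\<alpha> j)) M \<longrightarrow>
             C_const A f \<alpha> M \<le> 1 + c_grid q * ln (\<alpha> 0 / \<alpha> M))) \<and>
     (c_grid \<longlongrightarrow> 1) (at_left 1) \<and>
     (\<forall>p \<kappa> :: real. 0 < p \<and> p \<le> 2 \<and> 0 < \<kappa> \<longrightarrow>
        (\<exists>c>0. \<forall>(A :: 'h \<Rightarrow> 'f) (fstar :: 'f) (f :: 'f) (ustar :: 'h) (\<alpha> :: nat \<Rightarrow> real) (M :: nat)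
            (v :: 'h) (\<rho> :: real).
            tikhonov_problem q A fstar ustar \<alpha> M \<and> L_min A f \<alpha> M \<noteq> {} \<and>
            \<not> rises_from_initial_plateau (\<lambda>j. psiQ A f (\<alpha> j)) M \<and>
            ustar = operator_powr (operator_abs A) p v \<and> norm v \<le> \<rho> \<and> \<alpha> 0 = 1 \<and>
            sqrt (\<alpha> M) \<le> norm (f - fstar) \<and>
            nondegenerate \<kappa> p \<rho> (norm (f - fstar)) (sqrt (\<alpha> M)) \<longrightarrow>
              Min ((\<lambda>a. norm (tikhonov A f a - ustar)) ` L_min A f \<alpha> M)
                \<le> c * ln (norm (f - fstar) / sqrt (\<alpha> M)) * \<rho> powr (1 / (p + 1))
                    * \<bar>ln (norm (f - fstar))\<bar> * norm (f - fstar) powr (p / (p + 1))))"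
proof (intro conjI allI impI)
  fix A :: "'h \<Rightarrow> 'f" and fstar f :: 'f and ustar :: 'h and \<alpha> :: "nat \<Rightarrow> real" and M :: nat
  assume asm: "tikhonov_problem q A fstar ustar \<alpha> M \<and> L_min A f \<alpha> M \<noteq> {}"
  then have A: "bounded_linear A" and fstar: "fstar = A ustar" and pos0: "0 < \<alpha> 0"
    and step: "\<forall>j\<in>{1..M}. \<alpha> j = q * \<alpha> (j - 1)" and ne: "L_min A f \<alpha> M \<noteq> {}"
    by (auto simp: tikhonov_problem_def min_norm_solution_def)
  show "Min ((\<lambda>a. norm (tikhonov A f a - ustar)) ` L_min A f \<alpha> M)
      \<le> inverse q * C_const A f \<alpha> M * (INF a\<in>{\<alpha> M..\<alpha> 0}. e1 A fstar f ustar a)"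
    unfolding fstar by (rule min_error_le_Inf_e1[OF assms A pos0 step ne])
  show "C_const A f \<alpha> M \<le> 1 + c_grid q * ln (\<alpha> 0 / \<alpha> M)"
    if "\<not> rises_from_initial_plateau (\<lambda>j. psiQ A f (\<alpha> j)) M"
    using that by (rule C_const_le[OF assms A pos0 step ne])
next
  show "(c_grid \<longlongrightarrow> 1) (at_left 1)" by (rule c_grid_tendsto_1)
next
  fix p \<kappa> :: real assume "0 < p \<and> p \<le> 2 \<and> 0 < \<kappa>"
  then have p: "0 < p" "p \<le> 2" and \<kappa>: "0 < \<kappa>" by auto
  define c where "c = inverse q * (1 / \<kappa>\<^sup>2 + 4 * c_grid q / \<kappa>) * (2 * max 1 (\<kappa> powr (- 2 / (p + 1))))"
  have "0 \<le> c_grid q" using assms by (simp add: c_grid_def one_le_inverse less_imp_le)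
  then have "0 < 1 / \<kappa>\<^sup>2 + 4 * c_grid q / \<kappa>" using \<kappa> by (intro add_pos_nonneg) auto
  then have "0 < c" unfolding c_def using assms by (intro mult_pos_pos) auto
  then show "\<exists>c>0. \<forall>(A :: 'h \<Rightarrow> 'f) fstar f ustar \<alpha> M v \<rho>.
      tikhonov_problem q A fstar ustar \<alpha> M \<and> L_min A f \<alpha> M \<noteq> {} \<and>
      \<not> rises_from_initial_plateau (\<lambda>j. psiQ A f (\<alpha> j)) M \<and>
      ustar = operator_powr (operator_abs A) p v \<and> norm v \<le> \<rho> \<and> \<alpha> 0 = 1 \<and>
      sqrt (\<alpha> M) \<le> norm (f - fstar) \<and>
      nondegenerate \<kappa> p \<rho> (norm (f - fstar)) (sqrt (\<alpha> M)) \<longrightarrow>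
        Min ((\<lambda>a. norm (tikhonov A f a - ustar)) ` L_min A f \<alpha> M)
          \<le> c * ln (norm (f - fstar) / sqrt (\<alpha> M)) * \<rho> powr (1 / (p + 1))
              * \<bar>ln (norm (f - fstar))\<bar> * norm (f - fstar) powr (p / (p + 1))"
    unfolding c_def using rate_under_source_condition[OF assms p \<kappa>] by blast
qed

end
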